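(* Let $\alpha$ be an infinite cardinal. If $G$ is an $\alpha$-pseudocompact abelian group that is not $\alpha$-singular, then $r_0(N)=r_0(G)\geq 2^\alpha$ for every $N\in\Lambda_\alpha(G)$.
   Context: All topological spaces and groups are assumed to be Tychonov (in particular Hausdorff). Let $\alpha$ be an infinite cardinal. A topological space $X$ is $\alpha$-pseudocompact if $f(X)$ is compact for every continuous function $f:X\to\mathbb{R}^\alpha$; a topological group is $\alpha$-pseudocompact if its underlying space is. $r_0(A)$ denotes the free rank of an abelian group $A$, and $w(X)$ the weight of a space $X$ (minimum cardinality of a base). A topological abelian group $G$ is $\alpha$-singular if there exists a positive integer $m$ such that $w(mG)\leq\alpha$, where $mG=\{mx:x\in G\}$ has the subspace topology. A $G_\alpha$-set of a space $X$ is an intersection of $\alpha$ many open subsets of $X$. For a topological group $G$, $\Lambda_\alpha(G)$ is the family of all closed normal subgroups $N$ of $G$ that are $G_\alpha$-sets of $G$. *)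

theory Defs
  imports "HOL-Analysis.Analysis" "HOL-Algebra.Coset" "HOL-Algebra.FiniteProduct"
begin

unbundle cardinal_syntax

text \<open>A cardinal \<open>\<alpha>\<close> is a relation with \<^term>\<open>Card_order \<alpha>\<close>; its underlying set, used to index
  \<open>\<alpha>\<close> many objects, is \<^term>\<open>Field \<alpha>\<close>. Groups are written multiplicatively, so \<open>m x\<close> is
  \<open>x [^] m\<close>.\<close>

definition tychonoff_space :: "'a topology \<Rightarrow> bool" where
  "tychonoff_space X \<longleftrightarrow> completely_regular_space X \<and> Hausdorff_space X"

locale topological_group = group G for G :: "('a, 'b) monoid_scheme" (structure) +
  fixes T :: "'a topology"
  assumes topspace_eq_carrier: "topspace T = carrier G"
    and continuous_mult: "continuous_map (prod_topology T T) T (\<lambda>(x, y). x \<otimes> y)"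
    and continuous_inv: "continuous_map T T (\<lambda>x. inv x)"

definition pseudocompact_space :: "'k rel \<Rightarrow> 'a topology \<Rightarrow> bool" where
  "pseudocompact_space \<alpha> X \<longleftrightarrow>
     (\<forall>f. continuous_map X (powertop_real (Field \<alpha>)) f
          \<longrightarrow> compactin (powertop_real (Field \<alpha>)) (f ` topspace X))"

definition topology_base :: "'a topology \<Rightarrow> 'a set set \<Rightarrow> bool" where
  "topology_base X \<B> \<longleftrightarrow>
     (\<forall>V\<in>\<B>. openin X V) \<and>
     (\<forall>U x. openin X U \<and> x \<in> U \<longrightarrow> (\<exists>V\<in>\<B>. x \<in> V \<and> V \<subseteq> U))"

definition weight :: "'a topology \<Rightarrow> 'a set rel" where
  "weight X = |SOME \<B>. topology_base X \<B> \<and> (\<forall>\<B>'. topology_base X \<B>' \<longrightarrow> |\<B>| \<le>o |\<B>'| )|"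

lemma weight_attained:
  "\<exists>\<B>. topology_base X \<B> \<and> weight X = |\<B>| \<and> (\<forall>\<B>'. topology_base X \<B>' \<longrightarrow> |\<B>| \<le>o |\<B>'| )"
proof -
  let ?R = "card_of ` {\<B>. topology_base X \<B>}"
  have "topology_base X {U. openin X U}"
    unfolding topology_base_def by blast
  then have "?R \<noteq> {}" by blast
  moreover have "\<forall>r\<in>?R. Card_order r" using card_of_Card_order by auto
  ultimately have "\<exists>r\<in>?R. \<forall>r'\<in>?R. r \<le>o r'"
    by (rule exists_minim_Card_order)
  then have "\<exists>\<B>. topology_base X \<B> \<and> (\<forall>\<B>'. topology_base X \<B>' \<longrightarrow> |\<B>| \<le>o |\<B>'| )"
    by blast
  from someI_ex[OF this] show ?thesis
    unfolding weight_def by blast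
qed

lemma weight_ordLeq_iff: "weight X \<le>o r \<longleftrightarrow> (\<exists>\<B>. topology_base X \<B> \<and> |\<B>| \<le>o r)"
  using weight_attained[of X] ordLeq_transitive by metis

text \<open>Independence of a set of elements over the integers; in particular every element of an
  independent set has infinite order.\<close>

definition int_independent :: "('a, 'b) monoid_scheme \<Rightarrow> 'a set \<Rightarrow> bool" where
  "int_independent G B \<longleftrightarrow>
     B \<subseteq> carrier G \<and>
     (\<forall>F (c :: 'a \<Rightarrow> int). finite F \<and> F \<subseteq> B \<and> (\<Otimes>\<^bsub>G\<^esub>x\<in>F. x [^]\<^bsub>G\<^esub> c x) = \<one>\<^bsub>G\<^esub>
        \<longrightarrow> (\<forall>x\<in>F. c x = 0))"

definition maximal_int_independent :: "('a, 'b) monoid_scheme \<Rightarrow> 'a set \<Rightarrow> bool" where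
  "maximal_int_independent G B \<longleftrightarrow>
     int_independent G B \<and> (\<forall>B'. int_independent G B' \<and> B \<subseteq> B' \<longrightarrow> B' = B)"

text \<open>In an abelian group all maximal independent sets have the same cardinality, so the choice
  below does not matter.\<close>

definition free_rank :: "('a, 'b) monoid_scheme \<Rightarrow> 'a rel" where
  "free_rank G = |SOME B. maximal_int_independent G B|"

lemma maximal_int_independent_exists: "\<exists>B. maximal_int_independent G B"
proof -
  let ?A = "{B. int_independent G B}"
  have "\<exists>M\<in>?A. \<forall>X\<in>?A. M \<subseteq> X \<longrightarrow> X = M"
  proof (rule subset_Zorn_nonempty)
    have "int_independent G {}" by (auto simp: int_independent_def)
    then show "?A \<noteq> {}" by blast
  next
    fix C assume C: "C \<noteq> {}" "subset.chain ?A C"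
    have mem: "int_independent G B" if "B \<in> C" for B
      using C(2) that by (auto simp: subset.chain_def)
    have "int_independent G (\<Union>C)"
      unfolding int_independent_def
    proof (intro conjI allI impI)
      show "\<Union>C \<subseteq> carrier G" using mem by (auto simp: int_independent_def)
    next
      fix F and c :: "'a \<Rightarrow> int"
      assume F: "finite F \<and> F \<subseteq> \<Union>C \<and> (\<Otimes>\<^bsub>G\<^esub>x\<in>F. x [^]\<^bsub>G\<^esub> c x) = \<one>\<^bsub>G\<^esub>"
      then obtain B where "B \<in> C" "F \<subseteq> B"
        using finite_subset_Union_chain[of F C ?A] C by blast
      then show "\<forall>x\<in>F. c x = 0"
        using F mem[of B] unfolding int_independent_def by blast
    qed
    then show "\<Union>C \<in> ?A" by simp
  qed
  then show ?thesis
    unfolding maximal_int_independent_def by blast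
qed

definition singular_group :: "'k rel \<Rightarrow> ('a, 'b) monoid_scheme \<Rightarrow> 'a topology \<Rightarrow> bool" where
  "singular_group \<alpha> G T \<longleftrightarrow>
     (\<exists>m::nat. m > 0 \<and> weight (subtopology T ((\<lambda>x. x [^]\<^bsub>G\<^esub> m) ` carrier G)) \<le>o \<alpha>)"

definition G_set_in :: "'k rel \<Rightarrow> 'a topology \<Rightarrow> 'a set \<Rightarrow> bool" where
  "G_set_in \<alpha> X S \<longleftrightarrow>
     (\<exists>U. (\<forall>i\<in>Field \<alpha>. openin X (U i)) \<and> S = (\<Inter>i\<in>Field \<alpha>. U i))"

definition Lambda_family :: "'k rel \<Rightarrow> ('a, 'b) monoid_scheme \<Rightarrow> 'a topology \<Rightarrow> 'a set set" where
  "Lambda_family \<alpha> G T = {N. normal N G \<and> closedin T N \<and> G_set_in \<alpha> T N}"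

end

theory Submission
  imports Defs "HOL-Algebra.Free_Abelian_Groups"
begin

text \<open>Every \<open>N\<close> in the \<open>\<Lambda>\<^sub>\<alpha>\<close>-family contains the common zero set \<open>L\<close> of a system of at most \<open>\<alpha>\<close>
  continuous real functions that is a subgroup, because with every function the system contains
  one whose sublevel set \<open>V\<close> satisfies \<open>V V\<^sup>-\<^sup>1 \<subseteq> \<close> zeros of the first.  By \<open>\<alpha>\<close>-pseudocompactness,
  \<open>\<alpha>\<close> many zero sets with the finite intersection property meet, so \<open>G / L\<close> behaves like a compact
  group of weight at most \<open>\<alpha>\<close>; no completion, Haar measure or duality is needed.

  If \<open>k L\<close> is trivial, then \<open>k G\<close> is an image of \<open>G / L\<close> and has weight at most \<open>\<alpha>\<close>, so \<open>G\<close> is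
  singular.  Hence no such \<open>L\<close> is bounded, and nesting countably many of them shows that none is
  torsion.  Iterating this along \<open>\<alpha>\<close> gives a decreasing chain \<open>L \<beta>\<close> and elements \<open>x \<beta>\<close> of the
  earlier members having infinite order modulo \<open>L \<beta>\<close>; their (infinite) partial products over
  subsets of \<open>\<alpha>\<close> are \<open>2\<^sup>\<alpha>\<close> elements of \<open>L\<close> whose pairwise quotients have infinite order, so
  \<open>r\<^sub>0(N) \<ge> 2\<^sup>\<alpha>\<close>.  As \<open>G / N\<close> has at most \<open>2\<^sup>\<alpha>\<close> elements, \<open>r\<^sub>0(N) = r\<^sub>0(G)\<close>.\<close>

subsection \<open>Free rank and families without torsion differences\<close>

lemma card_of_Fpow_ordLeq_Cinfinite:
  assumes "Cinfinite \<kappa>" "|A| \<le>o \<kappa>"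
  shows "|Fpow A| \<le>o \<kappa>"
proof -
  have k: "|Field \<kappa>| =o \<kappa>" using assms(1) by (simp add: card_of_Field_ordIso)
  have "|A| \<le>o |Field \<kappa>|"
    using assms(2) k ordIso_symmetric ordLeq_ordIso_trans by blast
  then have "|Fpow A| \<le>o |Fpow (Field \<kappa>)|" by simp
  also have "|Fpow (Field \<kappa>)| =o |Field \<kappa>|"
    using assms(1) by (intro card_of_Fpow_infinite) (simp add: cinfinite_def)
  also note k
  finally show ?thesis .
qed

lemma card_of_Times_ordLeq_Cinfinite:
  assumes "Cinfinite \<kappa>" "|A| \<le>o \<kappa>" "|B| \<le>o \<kappa>"
  shows "|A \<times> B| \<le>o \<kappa>"
  using assms by (intro card_of_Times_ordLeq_infinite_Field) (auto simp: cinfinite_def)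

lemma countable_ordLeq_Cinfinite:
  assumes "Cinfinite \<kappa>" "countable A"
  shows "|A| \<le>o \<kappa>"
proof -
  obtain f :: "_ \<Rightarrow> nat" where "inj_on f A" using assms(2) by (rule countableE)
  then have "|A| \<le>o |UNIV :: nat set|" by (auto simp: card_of_ordLeq[symmetric])
  also have "|UNIV :: nat set| \<le>o \<kappa>"
    using assms(1) by (metis card_of_nat natLeq_ordLeq_cinfinite ordIso_ordLeq_trans)
  finally show ?thesis .
qed

text \<open>For a subset of an abelian group this says that the quotient of two distinct members has
  infinite order, so \<open>A\<close> embeds into the group modulo torsion. It is weaker than
  independence and easier to produce, yet a large set of this kind already bounds the free rank from
  below.\<close>

definition power_separated :: "('a, 'b) monoid_scheme \<Rightarrow> 'a set \<Rightarrow> bool" where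
  "power_separated G A \<longleftrightarrow>
     (\<forall>x\<in>A. \<forall>y\<in>A. \<forall>m::nat. m > 0 \<longrightarrow> x [^]\<^bsub>G\<^esub> m = y [^]\<^bsub>G\<^esub> m \<longrightarrow> x = y)"

text \<open>Adjoining \<open>y\<close> destroys independence, and the resulting relation has a
  nonzero coefficient at \<open>y\<close>, since otherwise it would be a relation within
  \<open>B\<close>. Solving for \<open>y\<close> with the appropriate sign leaves a positive
  exponent.\<close>

lemma (in comm_group) maximal_int_independent_power:
  assumes B: "maximal_int_independent G B" and y: "y \<in> carrier G"
  obtains m :: nat and F and c :: "'a \<Rightarrow> int"
  where "m > 0" "finite F" "F \<subseteq> B" "y [^] m = (\<Otimes>x\<in>F. x [^] c x)"
proof (cases "y \<in> B")
  case True
  have "(\<Otimes>x\<in>{y}. x [^] (1::int)) = y" using y by simp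
  then show ?thesis using that[of 1 "{y}" "\<lambda>_. 1"] True y by simp
next
  case False
  have indB: "int_independent G B" and BG: "B \<subseteq> carrier G"
    using B by (auto simp: maximal_int_independent_def int_independent_def)
  have "\<not> int_independent G (insert y B)"
    using B False unfolding maximal_int_independent_def by blast
  then obtain F and c :: "'a \<Rightarrow> int" where F: "finite F" "F \<subseteq> insert y B"
    "(\<Otimes>x\<in>F. x [^] c x) = \<one>" "\<exists>x\<in>F. c x \<noteq> 0"
    using BG y unfolding int_independent_def by auto
  have FG: "F \<subseteq> carrier G" using F BG y by auto
  define F' where "F' = F - {y}"
  have F': "finite F'" "F' \<subseteq> B" "F' \<subseteq> carrier G" "y \<notin> F'"
    using F FG by (auto simp: F'_def)
  have yF: "y \<in> F"
  proof (rule ccontr)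
    assume "y \<notin> F"
    then have "F \<subseteq> B" using F(2) by blast
    then show False using indB F unfolding int_independent_def by blast
  qed
  then have FF': "F = insert y F'" by (auto simp: F'_def)
  have P: "(\<Otimes>x\<in>F'. x [^] c x) \<in> carrier G"
    using F'(3) by (intro finprod_closed) auto
  have eq: "y [^] c y \<otimes> (\<Otimes>x\<in>F'. x [^] c x) = \<one>"
    using F(3) F' y unfolding FF' by (subst (asm) finprod_insert) auto
  have inv_prod: "inv (\<Otimes>x\<in>F'. x [^] c x) = (\<Otimes>x\<in>F'. x [^] (- c x))"
  proof -
    have "(\<Otimes>x\<in>F'. x [^] (- c x)) \<otimes> (\<Otimes>x\<in>F'. x [^] c x)
        = (\<Otimes>x\<in>F'. x [^] (- c x) \<otimes> x [^] c x)"
      using F'(3) by (subst finprod_multf) auto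
    also have "\<dots> = \<one>"
      using F'(3) by (intro finprod_one_eqI) (auto simp: int_pow_mult[symmetric])
    finally show ?thesis
      using F'(3) by (intro inv_equality P finprod_closed) auto
  qed
  have y_eq: "y [^] c y = (\<Otimes>x\<in>F'. x [^] (- c x))"
    using eq inv_prod P y by (metis int_pow_closed inv_equality)
  have y_eq': "y [^] (- c y) = (\<Otimes>x\<in>F'. x [^] c x)"
    using y_eq inv_prod P y int_pow_neg inv_inv by metis
  have "c y \<noteq> 0"
  proof
    assume c0: "c y = 0"
    then have "(\<Otimes>x\<in>F'. x [^] c x) = \<one>" using eq P by simp
    then have "\<forall>x\<in>F'. c x = 0" using indB F' unfolding int_independent_def by blast
    then show False using F(4) c0 FF' by blast
  qed
  then consider "c y > 0" | "c y < 0" by linarith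
  then show ?thesis
  proof cases
    case 1
    then have "y [^] nat (c y) = (\<Otimes>x\<in>F'. x [^] (- c x))"
      using y_eq by (metis int_pow_int int_nat_eq less_le)
    then show ?thesis using that[of "nat (c y)" F' "\<lambda>x. - c x"] 1 F' by simp
  next
    case 2
    then have "y [^] nat (- c y) = (\<Otimes>x\<in>F'. x [^] c x)"
      using y_eq' by (metis int_pow_int int_nat_eq less_le neg_0_less_iff_less)
    then show ?thesis using that[of "nat (- c y)" F' c] 2 F' by simp
  qed
qed

text \<open>A member of \<open>A\<close> is encoded by a positive exponent and a finite set of pairs
  (basis element, coefficient) describing that power. Equal codes give equal powers, hence equal
  members by separation, and there are at most \<kappa> codes.\<close>

lemma (in comm_group) card_of_ordLeq_maximal_int_independent:
  assumes B: "maximal_int_independent G B"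
    and \<kappa>: "Cinfinite \<kappa>" "|B| \<le>o \<kappa>"
    and A: "A \<subseteq> carrier G"
    and sep: "power_separated G A"
  shows "|A| \<le>o \<kappa>"
proof -
  let ?code = "\<lambda>E :: ('a \<times> int) set. \<Otimes>p\<in>E. fst p [^] snd p"
  have BG: "B \<subseteq> carrier G" using B by (auto simp: maximal_int_independent_def int_independent_def)
  have "\<exists>m E. m > (0::nat) \<and> E \<in> Fpow (B \<times> UNIV) \<and> y [^] m = ?code E" if yA: "y \<in> A" for y
  proof -
    obtain m :: nat and F and c :: "'a \<Rightarrow> int"
      where *: "m > 0" "finite F" "F \<subseteq> B" "y [^] m = (\<Otimes>x\<in>F. x [^] c x)"
      using maximal_int_independent_power[OF B] A yA by blast
    have "?code ((\<lambda>x. (x, c x)) ` F) = (\<Otimes>x\<in>F. x [^] c x)"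
      using * BG by (subst finprod_reindex) (auto simp: inj_on_def)
    then show ?thesis using * by (intro exI[of _ m] exI[of _ "(\<lambda>x. (x, c x)) ` F"]) (auto simp: Fpow_def)
  qed
  then obtain m E where mE: "\<And>y. y \<in> A \<Longrightarrow> m y > (0::nat) \<and> E y \<in> Fpow (B \<times> UNIV) \<and> y [^] m y = ?code (E y)"
    by metis
  have "inj_on (\<lambda>y. (m y, E y)) A"
    using mE sep unfolding inj_on_def power_separated_def by (metis prod.inject)
  moreover have "(\<lambda>y. (m y, E y)) ` A \<subseteq> UNIV \<times> Fpow (B \<times> UNIV)" using mE by auto
  ultimately have "|A| \<le>o |(UNIV :: nat set) \<times> Fpow (B \<times> (UNIV :: int set))|"
    by (auto simp: card_of_ordLeq[symmetric])
  also have "|(UNIV :: nat set) \<times> Fpow (B \<times> (UNIV :: int set))| \<le>o \<kappa>"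
    using \<kappa> by (intro card_of_Times_ordLeq_Cinfinite card_of_Fpow_ordLeq_Cinfinite)
      (auto intro: countable_ordLeq_Cinfinite)
  finally show ?thesis .
qed

text \<open>A finite \<open>B\<close> would make \<open>A\<close> countable, which the uncountable
  \<kappa> below \<open>|A|\<close> excludes. Once \<open>B\<close> is infinite, its own cardinality
  can serve as the bound in the preceding lemma.\<close>

lemma (in comm_group) ordLeq_card_of_maximal_int_independent:
  assumes B: "maximal_int_independent G B"
    and \<kappa>: "Card_order \<kappa>" "natLeq <o \<kappa>" "\<kappa> \<le>o |A|"
    and A: "A \<subseteq> carrier G"
    and sep: "power_separated G A"
  shows "infinite B" "|A| \<le>o |B|"
proof -
  show inf: "infinite B"
  proof
    assume "finite B"
    then have "|B| \<le>o natLeq"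
      by (intro countable_ordLeq_Cinfinite natLeq_Cinfinite countable_finite)
    then have "|A| \<le>o natLeq"
      using card_of_ordLeq_maximal_int_independent[OF B natLeq_Cinfinite _ A sep] by simp
    then show False
      using \<kappa> not_ordLess_ordLeq ordLeq_transitive by blast
  qed
  have "Cinfinite |B|" using inf by (simp add: cinfinite_def)
  then show "|A| \<le>o |B|"
    by (rule card_of_ordLeq_maximal_int_independent[OF B _ ordLeq_refl[OF card_of_Card_order] A sep])
qed

text \<open>Otherwise the coefficients \<open>m\<close> at \<open>x\<close> and \<open>-m\<close> at
  \<open>y\<close> form a nontrivial relation. Thus independent sets can themselves be counted
  against a maximal one, which is how two free ranks are compared.\<close>

lemma (in comm_group) int_independent_power_separated:
  assumes B: "int_independent G B"
  shows "power_separated G B"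
  unfolding power_separated_def
proof (intro ballI allI impI, rule ccontr)
  fix x y and m :: nat
  assume xy: "x \<in> B" "y \<in> B" and m: "m > 0" and eq: "x [^] m = y [^] m" and ne: "x \<noteq> y"
  let ?c = "\<lambda>z. if z = x then int m else - int m"
  have xyG: "x \<in> carrier G" "y \<in> carrier G" using B xy by (auto simp: int_independent_def)
  have "(\<Otimes>z\<in>{x, y}. z [^] ?c z) = x [^] int m \<otimes> y [^] (- int m)"
    using xyG ne by (subst finprod_insert) auto
  also have "\<dots> = \<one>" using xyG eq by (simp add: int_pow_neg int_pow_int)
  finally have "finite {x, y} \<and> {x, y} \<subseteq> B \<and> (\<Otimes>z\<in>{x, y}. z [^] ?c z) = \<one>"
    using xy by simp
  with B have "\<forall>z\<in>{x, y}. ?c z = 0"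
    unfolding int_independent_def by (elim conjE) (erule allE, erule allE[of _ ?c], erule mp, intro conjI)
  then show False using m by simp
qed

section \<open>Free rank of a subgroup of small index\<close>

lemma (in comm_group) subgroup_imp_comm_group:
  assumes "subgroup N G"
  shows "comm_group (G\<lparr>carrier := N\<rparr>)"
proof -
  interpret N: subgroup N G by (rule assms)
  have "group (G\<lparr>carrier := N\<rparr>)" by (rule N.subgroup_is_group) (rule group_axioms)
  then show ?thesis by (rule group.group_comm_groupI) (auto simp: m_comm)
qed

lemma (in comm_group) finprod_carrier_update:
  assumes N: "subgroup N G" and F: "finite F" "f \<in> F \<rightarrow> N"
  shows "finprod (G\<lparr>carrier := N\<rparr>) f F = finprod G f F"
proof -
  interpret N: comm_group "G\<lparr>carrier := N\<rparr>"
    using N by (rule subgroup_imp_comm_group)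
  have NG: "N \<subseteq> carrier G" using N by (rule subgroup.subset)
  show ?thesis
    using F
  proof (induction F rule: finite_induct)
    case (insert x F)
    have "f \<in> insert x F \<rightarrow> carrier G" using insert.prems NG by blast
    then show ?case
      using insert by (subst N.finprod_insert; (subst finprod_insert)?) auto
  qed simp
qed

lemma (in comm_group) int_independent_subgroup:
  assumes N: "subgroup N G" and B: "int_independent (G\<lparr>carrier := N\<rparr>) B"
  shows "int_independent G B"
proof -
  have BN: "B \<subseteq> N" using B by (simp add: int_independent_def)
  interpret N: subgroup N G by (rule N)
  have pow: "x [^]\<^bsub>G\<lparr>carrier := N\<rparr>\<^esub> (k::int) = x [^] k" if "x \<in> N" for x k
    using int_pow_consistent[OF N that] by simp
  show ?thesis
    unfolding int_independent_def
  proof (intro conjI allI impI)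
    show "B \<subseteq> carrier G" using BN N.subset by blast
    fix F and c :: "'a \<Rightarrow> int"
    assume F: "finite F \<and> F \<subseteq> B \<and> (\<Otimes>x\<in>F. x [^] c x) = \<one>"
    have closed: "(\<lambda>x. x [^] c x) \<in> F \<rightarrow> N"
      using F BN N by (auto intro!: group.subgroup_int_pow_closed group_axioms)
    interpret NG: comm_group "G\<lparr>carrier := N\<rparr>" using N by (rule subgroup_imp_comm_group)
    have "finprod (G\<lparr>carrier := N\<rparr>) (\<lambda>x. x [^]\<^bsub>G\<lparr>carrier := N\<rparr>\<^esub> c x) F
        = finprod (G\<lparr>carrier := N\<rparr>) (\<lambda>x. x [^] c x) F"
      using F BN closed pow by (intro NG.finprod_cong') auto
    also have "\<dots> = \<one>" using F closed by (simp add: finprod_carrier_update[OF N])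
    finally have "(\<Otimes>\<^bsub>G\<lparr>carrier := N\<rparr>\<^esub>x\<in>F. x [^]\<^bsub>G\<lparr>carrier := N\<rparr>\<^esub> c x) = \<one>\<^bsub>G\<lparr>carrier := N\<rparr>\<^esub>"
      by simp
    then show "\<forall>x\<in>F. c x = 0" using B F unfolding int_independent_def by blast
  qed
qed

lemma free_rank_maximal:
  obtains B where "maximal_int_independent G B" "free_rank G = |B|"
  using someI_ex[OF maximal_int_independent_exists[of G]] that unfolding free_rank_def by blast

text \<open>The map \<open>q\<close> stands in for the quotient map modulo \<open>N\<close>; it may
  be finer. It splits a maximal independent set \<open>B\<close> of \<open>G\<close> into at most
  \<kappa> fibres, each of which can be translated into \<open>N\<close> and so has at most
  \<open>|C|\<close> elements, where \<open>C\<close> is maximal independent in \<open>N\<close>.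
  The set \<open>A\<close> forces \<open>|C|\<close> to be infinite and at least \<kappa>, whence
  \<open>|B|\<close> is at most \<open>|C|\<close>.\<close>

lemma (in comm_group) free_rank_subgroup:
  fixes q :: "'a \<Rightarrow> 'c" and \<kappa> :: "'d rel"
  assumes N: "subgroup N G"
    and \<kappa>: "Card_order \<kappa>" "natLeq <o \<kappa>"
    and A: "A \<subseteq> N" "\<kappa> \<le>o |A|"
    and sep: "power_separated G A"
    and q: "|q ` carrier G| \<le>o \<kappa>"
      "\<And>x y. x \<in> carrier G \<Longrightarrow> y \<in> carrier G \<Longrightarrow> q x = q y \<Longrightarrow> x \<otimes> inv y \<in> N"
  shows "free_rank (G\<lparr>carrier := N\<rparr>) =o free_rank G \<and> \<kappa> \<le>o free_rank G"
proof -
  let ?N = "G\<lparr>carrier := N\<rparr>"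
  interpret SN: subgroup N G by (rule N)
  interpret N: comm_group ?N using N by (rule subgroup_imp_comm_group)
  have powN: "x [^]\<^bsub>?N\<^esub> (m::nat) = x [^] m" for x m by (simp add: nat_pow_def)
  have sepN: "power_separated ?N A" using sep by (simp add: power_separated_def powN)
  obtain C where C: "maximal_int_independent ?N C" "free_rank ?N = |C|" by (rule free_rank_maximal)
  obtain B where B: "maximal_int_independent G B" "free_rank G = |B|" by (rule free_rank_maximal)
  have BG: "B \<subseteq> carrier G" "int_independent G B"
    using B by (auto simp: maximal_int_independent_def int_independent_def)
  have CG: "int_independent G C" "C \<subseteq> carrier G"
    using int_independent_subgroup[OF N] C by (auto simp: maximal_int_independent_def int_independent_def)
  have AG: "A \<subseteq> carrier G" using A SN.subset by blast
  have "infinite C" "|A| \<le>o |C|"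
    using N.ordLeq_card_of_maximal_int_independent[OF C(1) \<kappa> A(2)] A(1) sepN by simp_all
  then have C_inf: "Cinfinite |C|" by (simp add: cinfinite_def)
  have \<kappa>C: "\<kappa> \<le>o |C|" using A(2) \<open>|A| \<le>o |C|\<close> by (rule ordLeq_transitive)
  have "infinite B" "|A| \<le>o |B|"
    using ordLeq_card_of_maximal_int_independent[OF B(1) \<kappa> A(2) AG sep] by blast+
  then have "Cinfinite |B|" by (simp add: cinfinite_def)
  then have CB: "|C| \<le>o |B|"
    by (rule card_of_ordLeq_maximal_int_independent[OF B(1) _ ordLeq_refl[OF card_of_Card_order] CG(2)
          int_independent_power_separated[OF CG(1)]])
  have fibre: "|{b \<in> B. q b = t}| \<le>o |C|" for t
  proof (cases "{b \<in> B. q b = t} = {}")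
    case True
    show ?thesis unfolding True by (rule card_of_empty)
  next
    case False
    then obtain b0 where b0: "b0 \<in> B" "q b0 = t" by blast
    \<comment> \<open>Division by the fixed \<open>b0\<close> moves the fibre injectively into
      \<open>N\<close> and keeps it power separated, although independence may be lost.\<close>
    define D where "D = (\<lambda>b. b \<otimes> inv b0) ` {b \<in> B. q b = t}"
    have b0G: "b0 \<in> carrier G" using b0 BG by blast
    have pw: "(b \<otimes> inv b0) [^] (m::nat) = b [^] m \<otimes> inv (b0 [^] m)" if "b \<in> B" for b m
      using that BG b0G by (simp add: nat_pow_distrib nat_pow_inv subset_iff)
    have D: "D \<subseteq> N" using q(2) b0 BG unfolding D_def by auto
    have "|D| \<le>o |C|"
    proof (rule N.card_of_ordLeq_maximal_int_independent[OF C(1) C_inf ordLeq_refl[OF card_of_Card_order]])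
      show "D \<subseteq> carrier ?N" using D by simp
      show "power_separated ?N D"
        unfolding power_separated_def
      proof (intro ballI allI impI)
        fix x y and m :: nat
        assume "x \<in> D" "y \<in> D" "m > 0" and e: "x [^]\<^bsub>?N\<^esub> m = y [^]\<^bsub>?N\<^esub> m"
        then obtain b b' where b: "b \<in> B" "b' \<in> B" "x = b \<otimes> inv b0" "y = b' \<otimes> inv b0"
          unfolding D_def by blast
        have bG: "b \<in> carrier G" "b' \<in> carrier G" using b BG by auto
        have "b [^] m \<otimes> inv (b0 [^] m) = b' [^] m \<otimes> inv (b0 [^] m)"
          using e b pw by (simp add: powN)
        then have "b [^] m = b' [^] m" using bG b0G by simp
        then show "x = y" using int_independent_power_separated[OF BG(2)] b \<open>m > 0\<close>
          unfolding power_separated_def by blast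
      qed
    qed
    moreover have "|{b \<in> B. q b = t}| \<le>o |D|"
    proof -
      have "inj_on (\<lambda>b. b \<otimes> inv b0) {b \<in> B. q b = t}"
        using BG b0G by (auto simp: inj_on_def subset_iff)
      then show ?thesis unfolding D_def by (auto simp: card_of_ordLeq[symmetric])
    qed
    ultimately show ?thesis using ordLeq_transitive by blast
  qed
  have "|\<Union>t\<in>q ` carrier G. {b \<in> B. q b = t}| \<le>o |C|"
    using fibre C_inf q(1) \<kappa>C ordLeq_transitive by (intro UNION_Cinfinite_bound) blast+
  moreover have "(\<Union>t\<in>q ` carrier G. {b \<in> B. q b = t}) = B" using BG by auto
  ultimately have "|B| \<le>o |C|" by simp
  then show ?thesis
    using CB \<kappa>C C(2) B(2) by (metis ordIso_iff_ordLeq ordLeq_transitive)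
qed

subsection \<open>Compactness of zero set families\<close>

text \<open>The functions are the coordinates of one continuous map into a power of the reals with
  exponent \<alpha>, repeated along a surjection of \<open>Field \<alpha>\<close> onto
  \<open>I\<close>. Its image is compact, and the closed sets where one coordinate vanishes have the
  finite intersection property on it.\<close>

lemma pseudocompact_space_common_zero:
  fixes f :: "'i \<Rightarrow> 'a \<Rightarrow> real"
  assumes \<alpha>: "Cinfinite \<alpha>" and X: "pseudocompact_space \<alpha> X" and I: "|I| \<le>o \<alpha>"
    and cont: "\<And>i. i \<in> I \<Longrightarrow> continuous_map X euclideanreal (f i)"
    and fin: "\<And>J. finite J \<Longrightarrow> J \<subseteq> I \<Longrightarrow> \<exists>x\<in>topspace X. \<forall>i\<in>J. f i x = 0"
  shows "\<exists>x\<in>topspace X. \<forall>i\<in>I. f i x = 0"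
proof (cases "I = {}")
  case True
  then show ?thesis using fin[of "{}"] by simp
next
  case False
  have "|I| \<le>o |Field \<alpha>|"
    using I \<alpha> card_of_Field_ordIso ordIso_symmetric ordLeq_ordIso_trans by blast
  then obtain p where p: "p ` Field \<alpha> = I" using iffD2[OF card_of_ordLeq2[OF False]] by blast
  let ?P = "powertop_real (Field \<alpha>)"
  define F where "F x = (\<lambda>k\<in>Field \<alpha>. f (p k) x)" for x
  have "continuous_map X ?P F"
    unfolding continuous_map_componentwise F_def using cont p by auto
  then have comp: "compactin ?P (F ` topspace X)" using X by (simp add: pseudocompact_space_def)
  define C where "C k = {q \<in> topspace ?P. q k \<in> {0::real}}" for k
  have closed: "closedin ?P (C k)" if "k \<in> Field \<alpha>" for k
    unfolding C_def
    by (rule closedin_continuous_map_preimage[OF continuous_map_product_projection[OF that]]) simp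
  have FC: "F x \<in> C k \<longleftrightarrow> f (p k) x = 0" if "k \<in> Field \<alpha>" for x k
    using that by (auto simp: C_def F_def)
  have "F ` topspace X \<inter> \<Inter>(C ` Field \<alpha>) \<noteq> {}"
  proof -
    have "F ` topspace X \<inter> \<Inter>\<F> \<noteq> {}" if "finite \<F>" "\<F> \<subseteq> C ` Field \<alpha>" for \<F>
    proof -
      obtain K where K: "K \<subseteq> Field \<alpha>" "finite K" "\<F> = C ` K"
        using finite_subset_image[OF \<open>finite \<F>\<close> \<open>\<F> \<subseteq> C ` Field \<alpha>\<close>] by blast
      then obtain x where "x \<in> topspace X" "\<forall>k\<in>K. f (p k) x = 0"
        using fin[of "p ` K"] p by auto
      then have "F x \<in> F ` topspace X \<inter> \<Inter>\<F>" using K FC by blast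
      then show ?thesis by blast
    qed
    moreover have "\<forall>D\<in>C ` Field \<alpha>. closedin ?P D" using closed by blast
    ultimately show ?thesis
      using comp[unfolded compactin_fip, THEN conjunct2, rule_format, of "C ` Field \<alpha>"] by metis
  qed
  then obtain x where "x \<in> topspace X" "\<forall>k\<in>Field \<alpha>. F x \<in> C k" by blast
  then show ?thesis using FC p by blast
qed

text \<open>The set \<open>Q \<E>\<close> consists of the points whose whole fibre lies in the union
  of \<E>; it is the complement of the image of what \<E> leaves uncovered. This is the classical
  argument that a continuous Hausdorff image of a compact space has no larger weight, with
  compactness and continuity stated only through the family \<W>, so that \<open>S\<close> needs no
  topology.\<close>

lemma topology_base_compact_image:
  fixes h :: "'a \<Rightarrow> 'b" and S :: "'a set" and \<W> :: "'a set set"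
  defines "Q \<equiv> \<lambda>\<E>. {z \<in> h ` S. \<forall>x\<in>S. h x = z \<longrightarrow> x \<in> \<Union>\<E>}"
  assumes Y: "Hausdorff_space Y" "topspace Y = h ` S"
    and cov: "\<And>\<C>. \<C> \<subseteq> \<W> \<Longrightarrow> S \<subseteq> \<Union>\<C> \<Longrightarrow> \<exists>\<D>. finite \<D> \<and> \<D> \<subseteq> \<C> \<and> S \<subseteq> \<Union>\<D>"
    and nbhd: "\<And>x U. x \<in> S \<Longrightarrow> openin Y U \<Longrightarrow> h x \<in> U \<Longrightarrow> \<exists>W\<in>\<W>. x \<in> W \<and> h ` (W \<inter> S) \<subseteq> U"
  shows "topology_base Y (Q ` Fpow \<W>)"
  unfolding topology_base_def
proof (intro conjI ballI allI impI)
  have sep: "\<exists>A W. openin Y A \<and> z \<in> A \<and> W \<in> \<W> \<and> y \<in> W \<and> A \<inter> h ` (W \<inter> S) = {}"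
    if zS: "z \<in> h ` S" and yS: "y \<in> S" and ne: "h y \<noteq> z" for z y
  proof -
    have zy: "z \<in> topspace Y" "h y \<in> topspace Y" using Y(2) zS yS by auto
    obtain A B where AB: "openin Y A" "openin Y B" "z \<in> A" "h y \<in> B" "disjnt A B"
      using Y(1) zy ne unfolding Hausdorff_space_def by metis
    obtain W where W: "W \<in> \<W>" "y \<in> W" "h ` (W \<inter> S) \<subseteq> B" using nbhd[OF yS AB(2,4)] by blast
    then have "A \<inter> h ` (W \<inter> S) = {}" using AB(5) by (auto simp: disjnt_def)
    then show ?thesis using AB W by blast
  qed
  fix V assume "V \<in> Q ` Fpow \<W>"
  then obtain \<E> where \<E>: "\<E> \<subseteq> \<W>" "finite \<E>" "V = Q \<E>" by (auto simp: Fpow_def)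
  show "openin Y V"
  proof (subst openin_subopen, intro ballI)
    fix z assume z: "z \<in> V"
    then have zS: "z \<in> h ` S" using \<E> by (simp add: Q_def)
    \<comment> \<open>Points of \<open>S'\<close> have images different from \<open>z\<close>, so
      each gets a neighbourhood \<open>W y\<close> whose image avoids an open set \<open>A y\<close>
      around \<open>z\<close>. Compactness leaves finitely many \<open>W y\<close> besides \<E>, and
      the intersection of their \<open>A y\<close> stays inside \<open>V\<close>.\<close>
    define S' where "S' = S - \<Union>\<E>"
    have "\<forall>y\<in>S'. \<exists>A W. openin Y A \<and> z \<in> A \<and> W \<in> \<W> \<and> y \<in> W \<and> A \<inter> h ` (W \<inter> S) = {}"
      using sep[OF zS] z \<E>(3) unfolding S'_def Q_def by blast
    then obtain A W where AW: "\<And>y. y \<in> S' \<Longrightarrow> openin Y (A y) \<and> z \<in> A y \<and> W y \<in> \<W> \<and> y \<in> W y \<and>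
        A y \<inter> h ` (W y \<inter> S) = {}"
      by metis
    have sub: "\<E> \<union> W ` S' \<subseteq> \<W>" using AW \<E>(1) by auto
    have "S \<subseteq> \<Union>(\<E> \<union> W ` S')"
    proof
      fix x assume "x \<in> S"
      then show "x \<in> \<Union>(\<E> \<union> W ` S')"
        using AW[of x] by (cases "x \<in> S'") (auto simp: S'_def)
    qed
    then obtain \<D> where \<D>: "finite \<D>" "\<D> \<subseteq> \<E> \<union> W ` S'" "S \<subseteq> \<Union>\<D>"
      using cov[OF sub] by metis
    have "finite (\<D> - \<E>)" "\<D> - \<E> \<subseteq> W ` S'" using \<D> by auto
    then obtain K where K: "finite K" "K \<subseteq> S'" "\<D> - \<E> = W ` K"
      using finite_subset_image by metis
    define B where "B = topspace Y \<inter> (\<Inter>y\<in>K. A y)"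
    have "openin Y B"
    proof (cases "K = {}")
      case False
      then show ?thesis unfolding B_def using K AW by (intro openin_Int openin_Inter) auto
    qed (simp add: B_def)
    moreover have "z \<in> B" using zS Y K AW unfolding B_def by auto
    moreover have "B \<subseteq> V"
    proof
      fix w assume w: "w \<in> B"
      have "x \<in> \<Union>\<E>" if x: "x \<in> S" "h x = w" for x
      proof (rule ccontr)
        assume "x \<notin> \<Union>\<E>"
        then obtain D where "D \<in> \<D> - \<E>" "x \<in> D" using \<D>(3) x(1) by blast
        then obtain y where "y \<in> K" "x \<in> W y" using K by auto
        then have "w \<in> A y \<inter> h ` (W y \<inter> S)" using w x unfolding B_def by auto
        then show False using AW K \<open>y \<in> K\<close> by blast
      qed
      then show "w \<in> V" using w Y unfolding B_def \<E> Q_def by auto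
    qed
    ultimately show "\<exists>B. openin Y B \<and> z \<in> B \<and> B \<subseteq> V" by blast
  qed
next
  fix U z assume U: "openin Y U \<and> z \<in> U"
  then have zS: "z \<in> h ` S" using Y openin_subset by blast
  \<comment> \<open>The cover has two kinds of members: those mapped into \<open>U\<close>, and
    those whose image misses \<open>z\<close>. In a finite subcover only the first kind can meet the
    fibre of \<open>z\<close>, and these form \<E>.\<close>
  have "\<forall>y\<in>S. \<exists>W\<in>\<W>. y \<in> W \<and> (h y = z \<and> h ` (W \<inter> S) \<subseteq> U \<or> h y \<noteq> z \<and> z \<notin> h ` (W \<inter> S))"
  proof
    fix y assume y: "y \<in> S"
    show "\<exists>W\<in>\<W>. y \<in> W \<and> (h y = z \<and> h ` (W \<inter> S) \<subseteq> U \<or> h y \<noteq> z \<and> z \<notin> h ` (W \<inter> S))"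
    proof (cases "h y = z")
      case True
      then show ?thesis using nbhd[OF y] U by blast
    next
      case False
      have "openin Y (topspace Y - {z})"
        using Y zS by (intro openin_diff[OF openin_topspace closedin_Hausdorff_singleton]) auto
      then show ?thesis using nbhd[OF y, of "topspace Y - {z}"] False y Y by blast
    qed
  qed
  then obtain W where W: "\<And>y. y \<in> S \<Longrightarrow> W y \<in> \<W> \<and> y \<in> W y \<and>
      (h y = z \<and> h ` (W y \<inter> S) \<subseteq> U \<or> h y \<noteq> z \<and> z \<notin> h ` (W y \<inter> S))"
    by metis
  have sub: "W ` S \<subseteq> \<W>" and "S \<subseteq> \<Union>(W ` S)" using W by auto
  then obtain \<D> where \<D>: "finite \<D>" "\<D> \<subseteq> W ` S" "S \<subseteq> \<Union>\<D>"
    using cov[OF sub] by metis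
  define \<E> where "\<E> = {D \<in> \<D>. h ` (D \<inter> S) \<subseteq> U}"
  have "\<E> \<in> Fpow \<W>" using \<D> W unfolding \<E>_def Fpow_def by auto
  moreover have "z \<in> Q \<E>"
  proof -
    have "x \<in> \<Union>\<E>" if x: "x \<in> S" "h x = z" for x
    proof -
      obtain D where D: "D \<in> \<D>" "x \<in> D" using \<D>(3) x(1) by auto
      then obtain y where "y \<in> S" "D = W y" using \<D>(2) by auto
      then have y: "y \<in> S" "x \<in> W y" "W y \<in> \<D>" using D by auto
      then have "z \<in> h ` (W y \<inter> S)" using x by blast
      then have "h ` (W y \<inter> S) \<subseteq> U" using W y by blast
      then show ?thesis using y unfolding \<E>_def by blast
    qed
    then show ?thesis using zS unfolding Q_def by auto
  qed
  moreover have "Q \<E> \<subseteq> U"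
    unfolding Q_def \<E>_def by blast
  ultimately show "\<exists>V\<in>Q ` Fpow \<W>. z \<in> V \<and> V \<subseteq> U" by blast
qed

subsection \<open>Subgroups cut out by null systems\<close>

locale pseudocompact_abelian_group = topological_group G T + comm_group G
  for G :: "('a, 'b) monoid_scheme" (structure) and T :: "'a topology" +
  fixes \<alpha> :: "'k rel"
  assumes Cinfinite: "Cinfinite \<alpha>"
    and tychonoff: "tychonoff_space T"
    and pseudocompact: "pseudocompact_space \<alpha> T"
begin

text \<open>The sublevel sets \<open>{f < 1}\<close> of a null system play the role of a family of neighbourhoods \<open>V\<close>
  of the identity containing with each \<open>V\<close> some \<open>W\<close> with \<open>W W\<^sup>-\<^sup>1 \<subseteq> V\<close>.  Demanding that \<open>f\<close> vanish,
  rather than \<open>f < 1\<close>, on \<open>W W\<^sup>-\<^sup>1\<close> makes their intersection a zero set and saves the construction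
  of invariant pseudometrics.\<close>

definition null_system :: "('a \<Rightarrow> real) set \<Rightarrow> bool" where
  "null_system \<F> \<longleftrightarrow> |\<F>| \<le>o \<alpha> \<and>
     (\<forall>f\<in>\<F>. continuous_map T euclideanreal f \<and> f \<one> = 0 \<and>
        (\<exists>g\<in>\<F>. \<forall>x\<in>carrier G. \<forall>y\<in>carrier G. g x < 1 \<longrightarrow> g y < 1 \<longrightarrow> f (x \<otimes> inv y) = 0))"

definition null_kernel :: "('a \<Rightarrow> real) set \<Rightarrow> 'a set" where
  "null_kernel \<F> = {x \<in> carrier G. \<forall>f\<in>\<F>. f x = 0}"

lemma null_systemD:
  assumes "null_system \<F>"
  shows "|\<F>| \<le>o \<alpha>"
    and "f \<in> \<F> \<Longrightarrow> continuous_map T euclideanreal f"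
    and "f \<in> \<F> \<Longrightarrow> f \<one> = 0"
  using assms unfolding null_system_def by auto

lemma null_systemE:
  assumes "null_system \<F>" "f \<in> \<F>"
  obtains g where "g \<in> \<F>"
    "\<And>x y. x \<in> carrier G \<Longrightarrow> y \<in> carrier G \<Longrightarrow> g x < 1 \<Longrightarrow> g y < 1 \<Longrightarrow> f (x \<otimes> inv y) = 0"
  using assms unfolding null_system_def by metis

text \<open>The function \<open>g\<close> that belongs to \<open>f\<close> vanishes on the kernel,
  hence is below 1 there, which forces \<open>f\<close> to vanish on quotients of kernel
  elements.\<close>

lemma subgroup_null_kernel:
  assumes "null_system \<F>"
  shows "subgroup (null_kernel \<F>) G"
proof -
  have one: "\<one> \<in> null_kernel \<F>" using null_systemD(3)[OF assms] by (simp add: null_kernel_def)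
  have diff: "x \<otimes> inv y \<in> null_kernel \<F>" if xy: "x \<in> null_kernel \<F>" "y \<in> null_kernel \<F>" for x y
  proof -
    have "f (x \<otimes> inv y) = 0" if "f \<in> \<F>" for f
      using null_systemE[OF assms that] xy unfolding null_kernel_def
      by (metis (mono_tags, lifting) mem_Collect_eq zero_less_one)
    then show ?thesis using xy unfolding null_kernel_def by simp
  qed
  have inv: "inv y \<in> null_kernel \<F>" if "y \<in> null_kernel \<F>" for y
    using diff[OF one that] that by (simp add: null_kernel_def)
  show ?thesis
  proof (rule subgroupI)
    fix x y assume "x \<in> null_kernel \<F>" "y \<in> null_kernel \<F>"
    then show "x \<otimes> y \<in> null_kernel \<F>"
      using diff[of x "inv y"] inv[of y] by (simp add: null_kernel_def)
  qed (use one inv in \<open>auto simp: null_kernel_def\<close>)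
qed

lemma null_system_UN:
  assumes I: "|I| \<le>o \<alpha>" and \<F>: "\<And>i. i \<in> I \<Longrightarrow> null_system (\<F> i)"
  shows "null_system (\<Union>i\<in>I. \<F> i)"
proof -
  have "|\<Union>i\<in>I. \<F> i| \<le>o \<alpha>"
    using null_systemD(1)[OF \<F>] by (intro UNION_Cinfinite_bound I Cinfinite) auto
  moreover have "continuous_map T euclideanreal f \<and> f \<one> = 0 \<and>
      (\<exists>g\<in>\<Union>i\<in>I. \<F> i. \<forall>x\<in>carrier G. \<forall>y\<in>carrier G. g x < 1 \<longrightarrow> g y < 1 \<longrightarrow> f (x \<otimes> inv y) = 0)"
    if "i \<in> I" "f \<in> \<F> i" for f i
    using \<F>[OF that(1)] that unfolding null_system_def by (metis UN_I)
  ultimately show ?thesis unfolding null_system_def by blast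
qed

lemma null_system_Un:
  assumes "null_system \<F>" "null_system \<G>"
  shows "null_system (\<F> \<union> \<G>)"
proof -
  have "null_system (\<Union>b\<in>UNIV. if b then \<F> else \<G>)"
    using assms Cinfinite by (intro null_system_UN countable_ordLeq_Cinfinite) auto
  moreover have "(\<Union>b\<in>UNIV. if b then \<F> else \<G>) = \<F> \<union> \<G>" by (auto split: if_splits)
  ultimately show ?thesis by simp
qed

lemma null_kernel_antimono: "\<F> \<subseteq> \<G> \<Longrightarrow> null_kernel \<G> \<subseteq> null_kernel \<F>"
  by (auto simp: null_kernel_def)

section \<open>Null systems inside neighbourhoods and \<Lambda>-subgroups\<close>

lemma continuous_map_translate:
  assumes "a \<in> carrier G" "continuous_map T Y f"
  shows "continuous_map T Y (\<lambda>x. f (x \<otimes> inv a))"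
proof -
  have "continuous_map T (prod_topology T T) (\<lambda>x. (x, inv a))"
    using assms topspace_eq_carrier by (intro continuous_map_pairedI) auto
  from continuous_map_compose[OF continuous_map_compose[OF this continuous_mult] assms(2)]
  show ?thesis by (simp add: o_def)
qed

lemma continuous_map_pow: "continuous_map T T (\<lambda>x. x [^] (n::nat))"
proof (induction n)
  case 0
  then show ?case using topspace_eq_carrier by simp
next
  case (Suc n)
  have "continuous_map T (prod_topology T T) (\<lambda>x. (x [^] n, x))"
    using Suc by (intro continuous_map_pairedI) (auto simp: continuous_map_id[unfolded id_def])
  from continuous_map_compose[OF this continuous_mult]
  show ?case by (simp add: o_def)
qed

lemma ex_continuous_null_near_one:
  assumes "openin T U" "\<one> \<in> U"
  obtains f V where "continuous_map T euclideanreal f" "openin T V" "\<one> \<in> V" "\<forall>x\<in>V. f x = 0"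
    "\<forall>x\<in>carrier G - U. f x \<ge> 1"
proof -
  have "closedin T (topspace T - U)" "\<one> \<in> topspace T - (topspace T - U)"
    using assms topspace_eq_carrier closedin_diff[OF closedin_topspace assms(1)] by simp_all
  then obtain f where f: "continuous_map T (top_of_set {0..1::real}) f" "f \<one> = 0"
      "f ` (topspace T - U) \<subseteq> {1}"
    using tychonoff unfolding tychonoff_space_def completely_regular_space_def by metis
  have fc: "continuous_map T euclideanreal f" using f(1) continuous_map_in_subtopology by blast
  show ?thesis
  \<comment> \<open>Complete regularity only gives a zero at the identity; truncating
    \<open>2 * f x - 1\<close> at 0 spreads it over the open set where \<open>f x < 1/2\<close> and
    keeps the value 1 outside \<open>U\<close>.\<close>
  proof (rule that[of "\<lambda>x. max 0 (2 * f x - 1)" "{x \<in> topspace T. f x \<in> {..<1/2}}"])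
    show "continuous_map T euclideanreal (\<lambda>x. max 0 (2 * f x - 1))"
      by (intro continuous_intros fc) auto
    show "openin T {x \<in> topspace T. f x \<in> {..<1/2}}"
      by (rule openin_continuous_map_preimage[OF fc]) simp
  qed (use f topspace_eq_carrier in auto)
qed

text \<open>The property \<open>P\<close> demands vanishing on a whole neighbourhood of the
  identity. Continuity of division then yields a smaller neighbourhood whose quotients stay in it,
  and a function at least 1 outside that smaller one is the next member. Iterating gives a countable
  null system.\<close>

lemma ex_null_system_subset:
  assumes "openin T U" "\<one> \<in> U"
  obtains \<F> where "null_system \<F>" "null_kernel \<F> \<subseteq> U"
proof -
  define P where "P f \<longleftrightarrow> continuous_map T euclideanreal f \<and> (\<exists>V. openin T V \<and> \<one> \<in> V \<and> (\<forall>x\<in>V. f x = 0))"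
    for f :: "'a \<Rightarrow> real"
  have step: "\<exists>g. P g \<and> (\<forall>x\<in>carrier G. \<forall>y\<in>carrier G. g x < 1 \<longrightarrow> g y < 1 \<longrightarrow> f (x \<otimes> inv y) = 0)"
    if Pf: "P f" for f
  proof -
    obtain V where V: "openin T V" "\<one> \<in> V" "\<forall>x\<in>V. f x = 0" using Pf P_def by blast
    have cont: "continuous_map (prod_topology T T) T (\<lambda>p. fst p \<otimes> inv (snd p))"
    proof -
      have "continuous_map (prod_topology T T) (prod_topology T T) (\<lambda>p. (fst p, inv (snd p)))"
        using continuous_map_compose[OF continuous_map_snd continuous_inv]
        by (intro continuous_map_pairedI continuous_map_fst) (simp add: o_def)
      from continuous_map_compose[OF this continuous_mult] show ?thesis by (simp add: o_def)
    qed
    define Z where "Z = {p \<in> topspace (prod_topology T T). fst p \<otimes> inv (snd p) \<in> V}"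
    have Z_open: "openin (prod_topology T T) Z"
      unfolding Z_def by (rule openin_continuous_map_preimage[OF cont V(1)])
    have Z_one: "(\<one>, \<one>) \<in> Z"
      using V topspace_eq_carrier by (simp add: Z_def)
    obtain A B where AB: "openin T A" "openin T B" "\<one> \<in> A" "\<one> \<in> B" "A \<times> B \<subseteq> Z"
      using openin_prod_topology_alt[THEN iffD1, rule_format, OF Z_open Z_one] by metis
    obtain g W where g: "continuous_map T euclideanreal g" "openin T W" "\<one> \<in> W" "\<forall>x\<in>W. g x = 0"
        "\<forall>x\<in>carrier G - A \<inter> B. g x \<ge> 1"
      using ex_continuous_null_near_one[of "A \<inter> B"] AB by blast
    have "f (x \<otimes> inv y) = 0" if xy: "x \<in> carrier G" "y \<in> carrier G" "g x < 1" "g y < 1" for x y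
    proof -
      have "x \<in> A \<inter> B" "y \<in> A \<inter> B"
        using bspec[OF g(5), of x] bspec[OF g(5), of y] xy by auto
      then have "(x, y) \<in> Z" using AB by blast
      then show ?thesis using V by (simp add: Z_def)
    qed
    then show ?thesis using g unfolding P_def by blast
  qed
  then obtain s where s: "\<And>f. P f \<Longrightarrow> P (s f) \<and>
      (\<forall>x\<in>carrier G. \<forall>y\<in>carrier G. s f x < 1 \<longrightarrow> s f y < 1 \<longrightarrow> f (x \<otimes> inv y) = 0)"
    by metis
  obtain f0 V where f0: "continuous_map T euclideanreal f0" "openin T V" "\<one> \<in> V" "\<forall>x\<in>V. f0 x = 0"
      "\<forall>x\<in>carrier G - U. f0 x \<ge> 1"
    using ex_continuous_null_near_one[OF assms] by blast
  define F where "F n = (s ^^ n) f0" for n :: nat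
  have F_Suc: "F (Suc n) = s (F n)" for n by (simp add: F_def)
  have PF: "P (F n)" for n
  proof (induction n)
    case 0
    then show ?case using f0 unfolding F_def P_def by auto
  next
    case (Suc n)
    then show ?case using s unfolding F_Suc by simp
  qed
  show ?thesis
  proof (rule that[of "range F"])
    have "\<exists>g\<in>range F. \<forall>x\<in>carrier G. \<forall>y\<in>carrier G. g x < 1 \<longrightarrow> g y < 1 \<longrightarrow> F n (x \<otimes> inv y) = 0" for n
      using s[OF PF[of n]] by (intro bexI[of _ "F (Suc n)"]) (simp_all add: F_Suc[symmetric])
    moreover have "|range F| \<le>o \<alpha>" using Cinfinite by (intro countable_ordLeq_Cinfinite) auto
    ultimately show "null_system (range F)"
      using PF unfolding null_system_def P_def by blast
    show "null_kernel (range F) \<subseteq> U"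
    proof
      fix x assume x: "x \<in> null_kernel (range F)"
      then have "F 0 x = 0" "x \<in> carrier G" by (auto simp: null_kernel_def)
      then show "x \<in> U" using f0(5) by (force simp: F_def)
    qed
  qed
qed

lemma ex_null_system_Lambda_family:
  assumes "N \<in> Lambda_family \<alpha> G T"
  obtains \<F> where "null_system \<F>" "null_kernel \<F> \<subseteq> N"
proof -
  obtain U where U: "\<And>i. i \<in> Field \<alpha> \<Longrightarrow> openin T (U i)" "N = (\<Inter>i\<in>Field \<alpha>. U i)"
    and N: "normal N G"
    using assms unfolding Lambda_family_def G_set_in_def by auto
  have "\<one> \<in> N" using N by (simp add: normal_imp_subgroup subgroup.one_closed)
  then have "\<forall>i\<in>Field \<alpha>. \<exists>\<F>. null_system \<F> \<and> null_kernel \<F> \<subseteq> U i"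
    using U ex_null_system_subset by (metis INT_E)
  then obtain \<F> where \<F>: "\<And>i. i \<in> Field \<alpha> \<Longrightarrow> null_system (\<F> i) \<and> null_kernel (\<F> i) \<subseteq> U i"
    by metis
  have "|Field \<alpha>| \<le>o \<alpha>" using Cinfinite by (simp add: card_of_Field_ordIso ordIso_imp_ordLeq)
  then have "null_system (\<Union>i\<in>Field \<alpha>. \<F> i)" using \<F> by (intro null_system_UN) auto
  moreover have "null_kernel (\<Union>i\<in>Field \<alpha>. \<F> i) \<subseteq> N"
    using \<F> U(2) by (force simp: null_kernel_def)
  ultimately show ?thesis by (rule that)
qed

text \<open>Removing powers of an element from the kernel is the purpose: if all positive powers are
  removed, the element has infinite order modulo the new kernel.\<close>

lemma null_system_refine:
  assumes \<H>: "null_system \<H>" and X: "countable X" "X \<subseteq> carrier G" "\<one> \<notin> X"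
  obtains \<F> where "null_system \<F>" "\<H> \<subseteq> \<F>" "null_kernel \<F> \<inter> X = {}"
proof -
  have "\<exists>\<F>. null_system \<F> \<and> x \<notin> null_kernel \<F>" if "x \<in> X" for x
  proof -
    have "x \<in> carrier G" "x \<noteq> \<one>" using X that by auto
    then obtain U where "openin T U" "\<one> \<in> U" "x \<notin> U"
      using tychonoff topspace_eq_carrier unfolding tychonoff_space_def Hausdorff_space_def disjnt_def
      by (metis disjoint_iff one_closed)
    then show ?thesis using ex_null_system_subset by (metis subsetD)
  qed
  then obtain \<F> where \<F>: "\<And>x. x \<in> X \<Longrightarrow> null_system (\<F> x) \<and> x \<notin> null_kernel (\<F> x)" by metis
  show ?thesis
  proof (rule that[of "\<H> \<union> (\<Union>x\<in>X. \<F> x)"])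
    show "null_system (\<H> \<union> (\<Union>x\<in>X. \<F> x))"
      using \<F> \<H> X Cinfinite by (intro null_system_Un null_system_UN countable_ordLeq_Cinfinite) auto
    show "null_kernel (\<H> \<union> (\<Union>x\<in>X. \<F> x)) \<inter> X = {}"
      using \<F> by (fastforce simp: null_kernel_def)
  qed simp
qed

text \<open>A coset of a null kernel is the common zero set of translates of the system, so \<alpha>
  many cosets with the finite intersection property meet. This is the substitute for limits in a
  completion.\<close>

lemma null_kernel_cosets_common_point:
  assumes I: "|I| \<le>o \<alpha>"
    and \<F>: "\<And>i. i \<in> I \<Longrightarrow> null_system (\<F> i)" "\<And>i. i \<in> I \<Longrightarrow> y i \<in> carrier G"
    and fin: "\<And>J. finite J \<Longrightarrow> J \<subseteq> I \<Longrightarrow> \<exists>z\<in>carrier G. \<forall>i\<in>J. z \<otimes> inv (y i) \<in> null_kernel (\<F> i)"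
  obtains z where "z \<in> carrier G" "\<And>i. i \<in> I \<Longrightarrow> z \<otimes> inv (y i) \<in> null_kernel (\<F> i)"
proof -
  let ?h = "\<lambda>(i, f) x. f (x \<otimes> inv (y i)) :: real"
  have "\<exists>z\<in>topspace T. \<forall>p\<in>Sigma I \<F>. ?h p z = 0"
  proof (rule pseudocompact_space_common_zero[OF Cinfinite pseudocompact])
    show "|Sigma I \<F>| \<le>o \<alpha>"
      using Cinfinite I \<F>(1) null_systemD(1)
      by (intro card_of_Sigma_ordLeq_infinite_Field) (auto simp: cinfinite_def)
    show "continuous_map T euclideanreal (?h p)" if "p \<in> Sigma I \<F>" for p
      using that continuous_map_translate[OF \<F>(2) null_systemD(2)[OF \<F>(1)]] by (cases p) auto
    fix J assume J: "finite J" "J \<subseteq> Sigma I \<F>"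
    then have "finite (fst ` J)" "fst ` J \<subseteq> I" by auto
    then obtain z where "z \<in> carrier G" "\<forall>i\<in>fst ` J. z \<otimes> inv (y i) \<in> null_kernel (\<F> i)"
      using fin by blast
    then show "\<exists>z\<in>topspace T. \<forall>p\<in>J. ?h p z = 0"
      using J(2) topspace_eq_carrier unfolding null_kernel_def by (intro bexI[of _ z]) force+
  qed
  then obtain z where "z \<in> carrier G" "\<forall>p\<in>Sigma I \<F>. ?h p z = 0" using topspace_eq_carrier by blast
  then show ?thesis using \<F>(2) that[of z] unfolding null_kernel_def by auto
qed

subsection \<open>Total boundedness\<close>

lemma cancel_right_translates:
  assumes "x \<in> carrier G" "y \<in> carrier G" "a \<in> carrier G"
  shows "x \<otimes> inv a \<otimes> inv (y \<otimes> inv a) = x \<otimes> inv y"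
proof -
  have "inv a \<otimes> (a \<otimes> inv y) = inv y" using assms by (simp add: m_assoc[symmetric])
  then show ?thesis using assms by (simp add: inv_mult_group m_assoc)
qed

lemma cancel_left_translates:
  assumes "x \<in> carrier G" "y \<in> carrier G" "a \<in> carrier G"
  shows "a \<otimes> inv x \<otimes> inv (a \<otimes> inv y) = y \<otimes> inv x"
  using cancel_right_translates[of "inv x" "inv y" "inv a"] assms by (simp add: m_comm)

text \<open>Both \<open>s m\<close> and \<open>s n\<close> are \<open>g\<close>-close to
  \<open>z\<close> by the choice of \<open>h\<close>, hence \<open>f\<close>-close to each other by
  the choice of \<open>g\<close>, which separation allows only for \<open>m = n\<close>. So the
  \<open>h\<close>-neighbourhood of \<open>z\<close> meets at most one near set.\<close>

lemma null_system_separated_unique: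
  assumes g: "\<And>x y. x \<in> carrier G \<Longrightarrow> y \<in> carrier G \<Longrightarrow> g x < 1 \<Longrightarrow> g y < 1 \<Longrightarrow> f (x \<otimes> inv y) = 0"
    and h: "\<And>x y. x \<in> carrier G \<Longrightarrow> y \<in> carrier G \<Longrightarrow> h x < 1 \<Longrightarrow> h y < 1 \<Longrightarrow> g (x \<otimes> inv y) = (0::real)"
    and s: "\<And>n. s n \<in> carrier G" "\<And>m n. m < n \<Longrightarrow> f (s n \<otimes> inv (s m)) \<ge> (1::real)"
    and G: "x \<in> carrier G" "y \<in> carrier G" "z \<in> carrier G"
    and z: "h (x \<otimes> inv z) < 1" "h (y \<otimes> inv z) < (1::real)"
    and mn: "h (x \<otimes> inv (s m)) < 1" "h (y \<otimes> inv (s n)) < 1"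
  shows "m = (n :: nat)"
proof -
  have "g (s m \<otimes> inv z) = 0" "g (s n \<otimes> inv z) = 0"
    using h[of "x \<otimes> inv z" "x \<otimes> inv (s m)"] h[of "y \<otimes> inv z" "y \<otimes> inv (s n)"] s(1) G z mn
      cancel_left_translates
    by simp_all
  then have "f (s m \<otimes> inv z \<otimes> inv (s n \<otimes> inv z)) = 0" "f (s n \<otimes> inv z \<otimes> inv (s m \<otimes> inv z)) = 0"
    using g s(1) G by simp_all
  then have "f (s m \<otimes> inv (s n)) = 0" "f (s n \<otimes> inv (s m)) = 0"
    using s(1) G cancel_right_translates by simp_all
  then show ?thesis using s(2)[of m n] s(2)[of n m] by (cases m n rule: linorder_cases) auto
qed

text \<open>Otherwise there is an infinite sequence of points \<open>s n\<close> any two of which are \<open>f\<close>-far apart.  The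
  sets \<open>near\<close> the \<open>s n\<close> are locally finite, hence the continuous function \<open>\<psi>\<close>, which vanishes at all
  \<open>s n\<close> and is \<open>1\<close> away from these sets.  Its zero set and the complements of the near sets violate the
  compactness of zero set families.\<close>

lemma null_system_totally_bounded:
  assumes \<F>: "null_system \<F>" "f \<in> \<F>"
  shows "\<exists>D. finite D \<and> D \<subseteq> carrier G \<and> (\<forall>x\<in>carrier G. \<exists>a\<in>D. f (x \<otimes> inv a) < 1)"
proof (rule ccontr)
  assume "\<not> ?thesis"
  then have pick: "\<exists>x\<in>carrier G. \<forall>a\<in>D. f (x \<otimes> inv a) \<ge> 1" if "finite D" "D \<subseteq> carrier G" for D
    using that by (meson linorder_not_le)
  have "\<exists>s. \<forall>n::nat. s n \<in> carrier G \<and> (\<forall>m<n. f (s n \<otimes> inv (s m)) \<ge> 1)"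
  proof (rule dependent_wellorder_choice)
    fix r and s s' :: "nat \<Rightarrow> 'a" and n
    assume "\<And>m. m < n \<Longrightarrow> s m = s' m"
    then show "(r \<in> carrier G \<and> (\<forall>m<n. f (r \<otimes> inv (s m)) \<ge> 1)) =
        (r \<in> carrier G \<and> (\<forall>m<n. f (r \<otimes> inv (s' m)) \<ge> 1))" by auto
  next
    fix n and s :: "nat \<Rightarrow> 'a"
    assume "\<And>m. m < n \<Longrightarrow> s m \<in> carrier G \<and> (\<forall>k<m. f (s m \<otimes> inv (s k)) \<ge> 1)"
    then have "s ` {..<n} \<subseteq> carrier G" by auto
    then show "\<exists>r. r \<in> carrier G \<and> (\<forall>m<n. f (r \<otimes> inv (s m)) \<ge> 1)"
      using pick[of "s ` {..<n}"] by auto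
  qed
  then obtain s where "\<forall>n::nat. s n \<in> carrier G \<and> (\<forall>m<n. f (s n \<otimes> inv (s m)) \<ge> 1)"
    by (rule exE)
  then have s: "\<And>n. s n \<in> carrier G" "\<And>m n. m < n \<Longrightarrow> f (s n \<otimes> inv (s m)) \<ge> 1" by simp_all
  obtain g where g: "g \<in> \<F>"
    "\<And>x y. x \<in> carrier G \<Longrightarrow> y \<in> carrier G \<Longrightarrow> g x < 1 \<Longrightarrow> g y < 1 \<Longrightarrow> f (x \<otimes> inv y) = 0"
    by (rule null_systemE[OF \<F>]) blast
  obtain h where h: "h \<in> \<F>"
    "\<And>x y. x \<in> carrier G \<Longrightarrow> y \<in> carrier G \<Longrightarrow> h x < 1 \<Longrightarrow> h y < 1 \<Longrightarrow> g (x \<otimes> inv y) = 0"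
    by (rule null_systemE[OF \<F>(1) g(1)]) blast
  note unique = null_system_separated_unique[where f = f and g = g and h = h and s = s, OF g(2) h(2) s]
  have h1: "h \<one> = 0" by (rule null_systemD(3)[OF \<F>(1) h(1)])
  have h_cont: "continuous_map T euclideanreal (\<lambda>x. h (x \<otimes> inv a))" if "a \<in> carrier G" for a
    by (rule continuous_map_translate[OF that null_systemD(2)[OF \<F>(1) h(1)]])
  define near where "near x n \<longleftrightarrow> h (x \<otimes> inv (s n)) < 1" for x n
  \<comment> \<open>The choice is harmless: a point is near at most one \<open>s n\<close>.\<close>
  define \<psi> where "\<psi> x = (if \<exists>n. near x n then h (x \<otimes> inv (s (SOME n. near x n))) else 1)" for x
  define V where "V z = {x \<in> topspace T. h (x \<otimes> inv z) \<in> {..<1}}" for z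
  have \<psi>_cont: "continuous_map T euclideanreal \<psi>"
  proof (rule pasting_lemma[where I = "carrier G" and T = V and f = "\<lambda>_. \<psi>"])
    fix z assume z: "z \<in> carrier G"
    show "openin T (V z)"
      unfolding V_def by (rule openin_continuous_map_preimage[OF h_cont[OF z]]) simp
    have "\<exists>\<phi>. continuous_map T euclideanreal \<phi> \<and> (\<forall>x\<in>V z. \<psi> x = \<phi> x)"
    proof (cases "\<exists>x\<in>V z. \<exists>n. near x n")
      case True
      then obtain x0 n where n: "x0 \<in> V z" "near x0 n" by blast
      \<comment> \<open>On \<open>V z\<close> no index other than \<open>n\<close> can occur, so
        \<psi> agrees there with a single truncated continuous function.\<close>
      have "\<psi> x = min 1 (h (x \<otimes> inv (s n)))" if x: "x \<in> V z" for x
      proof -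
        have only: "m = n" if "near x m" for m
          using unique[of x x0 z m n] that n x z topspace_eq_carrier by (auto simp: V_def near_def)
        show ?thesis
        proof (cases "near x n")
          case True
          then have "(SOME n. near x n) = n" using only by (metis someI)
          then show ?thesis using True by (auto simp: \<psi>_def near_def)
        next
          case False
          then have "\<not> (\<exists>m. near x m)" using only by blast
          then have "\<psi> x = 1" by (simp add: \<psi>_def)
          moreover have "h (x \<otimes> inv (s n)) \<ge> 1" using False by (simp add: near_def)
          ultimately show ?thesis by simp
        qed
      qed
      moreover have "continuous_map T euclideanreal (\<lambda>x. min 1 (h (x \<otimes> inv (s n))))"
        by (intro continuous_intros h_cont s) auto
      ultimately show ?thesis by blast
    next
      case False
      then have "\<psi> x = 1" if "x \<in> V z" for x using that by (auto simp: \<psi>_def)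
      then show ?thesis by (intro exI[of _ "\<lambda>_. 1"]) auto
    qed
    then obtain \<phi> where \<phi>: "continuous_map T euclideanreal \<phi>" "\<And>x. x \<in> V z \<Longrightarrow> \<psi> x = \<phi> x"
      by blast
    show "continuous_map (subtopology T (V z)) euclideanreal \<psi>"
      by (rule continuous_map_eq[OF continuous_map_from_subtopology[OF \<phi>(1)]]) (simp add: \<phi>(2))
  next
    fix x assume "x \<in> topspace T"
    then show "\<exists>j. j \<in> carrier G \<and> x \<in> V j \<and> \<psi> x = \<psi> x"
      using h1 topspace_eq_carrier by (intro exI[of _ x]) (auto simp: V_def)
  qed simp
  \<comment> \<open>The index \<open>None\<close> stands for the zero set of \<psi>, and
    \<open>Some n\<close> for the complement of the near set of \<open>s n\<close>. A finite index
    set omits some \<open>Some n\<close>, and then \<open>s n\<close> is a common zero; a zero of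
    all of them would have \<psi> equal to both 0 and 1.\<close>
  let ?k = "\<lambda>i x. case i of None \<Rightarrow> \<psi> x | Some n \<Rightarrow> max 0 (1 - h (x \<otimes> inv (s n)))"
  have "\<exists>x\<in>topspace T. \<forall>i\<in>UNIV. ?k i x = 0"
  proof (rule pseudocompact_space_common_zero[OF Cinfinite pseudocompact])
    show "|UNIV :: nat option set| \<le>o \<alpha>" by (intro countable_ordLeq_Cinfinite Cinfinite) auto
    show "continuous_map T euclideanreal (?k i)" for i
    proof (cases i)
      case (Some n)
      have "continuous_map T euclideanreal (\<lambda>x. max 0 (1 - h (x \<otimes> inv (s n))))"
        by (intro continuous_intros h_cont s) auto
      then show ?thesis using Some by simp
    qed (simp add: \<psi>_cont)
    fix J :: "nat option set" assume "finite J"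
    then have "finite (Some -` J)" by (intro finite_vimageI) auto
    then obtain n where n: "Some n \<notin> J" using ex_new_if_finite[OF infinite_UNIV_nat] by blast
    have self: "h (s n \<otimes> inv (s n)) = 0" using s h1 by simp
    have only: "m = n" if "near (s n) m" for m
      using unique[of "s n" "s n" "s n" m n] that self s by (simp add: near_def)
    have "near (s n) n" using self by (simp add: near_def)
    then have "(SOME k. near (s n) k) = n" using only by (metis someI)
    then have "\<psi> (s n) = 0" using \<open>near (s n) n\<close> self by (auto simp: \<psi>_def)
    moreover have "max 0 (1 - h (s n \<otimes> inv (s m))) = 0" if "Some m \<in> J" for m
    proof -
      have "\<not> near (s n) m" using only n that by blast
      then show ?thesis by (simp add: near_def)
    qed
    ultimately show "\<exists>x\<in>topspace T. \<forall>i\<in>J. ?k i x = 0"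
      using s topspace_eq_carrier by (intro bexI[of _ "s n"]) (auto split: option.split)
  qed
  then obtain x where x: "\<And>i. ?k i x = 0" by blast
  have "\<psi> x = 0" using x[of None] by simp
  moreover have "\<not> near x n" for n using x[of "Some n"] by (simp add: near_def max_def split: if_splits)
  then have "\<psi> x = 1" by (simp add: \<psi>_def)
  ultimately show False by simp
qed

lemma null_system_net:
  assumes "null_system \<F>"
  obtains D where "|Sigma \<F> D| \<le>o \<alpha>" "\<And>f. f \<in> \<F> \<Longrightarrow> D f \<subseteq> carrier G"
    "\<And>f x. f \<in> \<F> \<Longrightarrow> x \<in> carrier G \<Longrightarrow> \<exists>a\<in>D f. f (x \<otimes> inv a) < 1"
proof -
  obtain D where D: "\<And>f. f \<in> \<F> \<Longrightarrow> finite (D f) \<and> D f \<subseteq> carrier G \<and>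
      (\<forall>x\<in>carrier G. \<exists>a\<in>D f. f (x \<otimes> inv a) < 1)"
    using null_system_totally_bounded[OF assms] by metis
  have "|Sigma \<F> D| \<le>o \<alpha>"
  proof (rule card_of_Sigma_ordLeq_infinite_Field)
    show "\<forall>f\<in>\<F>. |D f| \<le>o \<alpha>"
      using D by (auto intro!: countable_ordLeq_Cinfinite Cinfinite countable_finite)
  qed (use Cinfinite null_systemD(1)[OF assms] in \<open>auto simp: cinfinite_def\<close>)
  then show ?thesis using D that[of D] by blast
qed

text \<open>The value \<open>q x\<close> records which net points are close to \<open>x\<close>. Two
  elements with the same record share a close net point for every member of the system, so their
  quotient is killed by all of them; a record is a subset of a set of size at most \<alpha>.\<close>

lemma null_kernel_index:
  assumes "null_system \<F>"
  obtains q :: "'a \<Rightarrow> (('a \<Rightarrow> real) \<times> 'a) set" where "|q ` carrier G| \<le>o ctwo ^c \<alpha>"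
    "\<And>x y. x \<in> carrier G \<Longrightarrow> y \<in> carrier G \<Longrightarrow> q x = q y \<Longrightarrow> x \<otimes> inv y \<in> null_kernel \<F>"
proof -
  obtain D where D: "|Sigma \<F> D| \<le>o \<alpha>" "\<And>f. f \<in> \<F> \<Longrightarrow> D f \<subseteq> carrier G"
    "\<And>f x. f \<in> \<F> \<Longrightarrow> x \<in> carrier G \<Longrightarrow> \<exists>a\<in>D f. f (x \<otimes> inv a) < 1"
    by (rule null_system_net[OF assms]) blast
  define q where "q x = {(f, a) \<in> Sigma \<F> D. f (x \<otimes> inv a) < 1}" for x
  show ?thesis
  proof (rule that[of q])
    have "|q ` carrier G| \<le>o |Pow (Sigma \<F> D)|"
      by (intro card_of_mono1) (auto simp: q_def)
    also have "|Pow (Sigma \<F> D)| \<le>o |Pow (Field \<alpha>)|"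
    proof (rule card_of_Pow_mono)
      have "\<alpha> =o |Field \<alpha>|" using Cinfinite by (simp add: card_of_Field_ordIso ordIso_symmetric)
      then show "|Sigma \<F> D| \<le>o |Field \<alpha>|" using D(1) by (rule ordLeq_ordIso_trans[rotated])
    qed
    also have "|Pow (Field \<alpha>)| =o ctwo ^c \<alpha>" using cpow_cexp_ctwo unfolding cpow_def .
    finally show "|q ` carrier G| \<le>o ctwo ^c \<alpha>" .
  next
    fix x y assume xy: "x \<in> carrier G" "y \<in> carrier G" "q x = q y"
    have "f (x \<otimes> inv y) = 0" if f: "f \<in> \<F>" for f
    proof -
      obtain g where g: "g \<in> \<F>"
        "\<And>x y. x \<in> carrier G \<Longrightarrow> y \<in> carrier G \<Longrightarrow> g x < 1 \<Longrightarrow> g y < 1 \<Longrightarrow> f (x \<otimes> inv y) = 0"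
        by (rule null_systemE[OF assms f]) blast
      obtain a where a: "a \<in> D g" "g (x \<otimes> inv a) < 1" using D(3)[OF g(1) xy(1)] by blast
      then have "(g, a) \<in> q x" using g(1) by (simp add: q_def)
      then have "(g, a) \<in> q y" using xy(3) by simp
      then have "g (y \<otimes> inv a) < 1" by (simp add: q_def)
      moreover have "a \<in> carrier G" using a D(2)[OF g(1)] by blast
      ultimately show ?thesis
        using g(2)[of "x \<otimes> inv a" "y \<otimes> inv a"] a xy cancel_right_translates[of x y a] by simp
    qed
    then show "x \<otimes> inv y \<in> null_kernel \<F>" using xy by (simp add: null_kernel_def)
  qed
qed

section \<open>Bounded null kernels and singularity\<close>

text \<open>With a finite net for every member of the null system at hand, finite intersections of
  translates \<open>{y. f (y a\<^sup>-\<^sup>1) < 1}\<close> give \<open>\<alpha>\<close> many cozero sets which generate a compact topology on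
  \<open>G\<close> (that of \<open>G\<close> modulo the null kernel); the \<open>k\<close>-th power map is continuous for it.\<close>

lemma singular_group_if_null_kernel_bounded:
  assumes \<F>: "null_system \<F>" and k: "k > 0" and bounded: "\<And>x. x \<in> null_kernel \<F> \<Longrightarrow> x [^] (k::nat) = \<one>"
  shows "singular_group \<alpha> G T"
proof -
  let ?p = "\<lambda>x. x [^] k"
  let ?Y = "subtopology T (?p ` carrier G)"
  obtain D where D: "|Sigma \<F> D| \<le>o \<alpha>" "\<And>f. f \<in> \<F> \<Longrightarrow> D f \<subseteq> carrier G"
    "\<And>f x. f \<in> \<F> \<Longrightarrow> x \<in> carrier G \<Longrightarrow> \<exists>a\<in>D f. f (x \<otimes> inv a) < 1"
    by (rule null_system_net[OF \<F>]) blast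
  define W where "W E = {y \<in> carrier G. \<forall>e\<in>E. fst e (y \<otimes> inv (snd e)) < (1::real)}" for E
  define \<W> where "\<W> = W ` Fpow (Sigma \<F> D)"
  have "|\<W>| \<le>o |Fpow (Sigma \<F> D)|" unfolding \<W>_def by (rule card_of_image)
  then have "|\<W>| \<le>o \<alpha>"
    by (rule ordLeq_transitive[OF _ card_of_Fpow_ordLeq_Cinfinite[OF Cinfinite D(1)]])
  then have \<W>_card: "|Fpow \<W>| \<le>o \<alpha>" by (rule card_of_Fpow_ordLeq_Cinfinite[OF Cinfinite])
  have top_Y: "topspace ?Y = ?p ` carrier G"
    using topspace_eq_carrier by auto
  have cov: "\<exists>\<D>. finite \<D> \<and> \<D> \<subseteq> \<C> \<and> carrier G \<subseteq> \<Union>\<D>" if \<C>: "\<C> \<subseteq> \<W>" "carrier G \<subseteq> \<Union>\<C>" for \<C>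
  proof (rule ccontr)
    assume no: "\<not> ?thesis"
    obtain \<E> where \<E>: "\<E> \<subseteq> Fpow (Sigma \<F> D)" "\<C> = W ` \<E>"
      using \<C>(1) unfolding \<W>_def by (meson subset_imageE)
    \<comment> \<open>This function is nonzero exactly on \<open>W E\<close>, so a family of sets
      \<open>W E\<close> without finite subcover becomes a family of zero sets with the finite
      intersection property.\<close>
    let ?w = "\<lambda>E y. \<Prod>e\<in>E. max 0 (1 - fst e (y \<otimes> inv (snd e)))"
    have w0: "?w E y = 0 \<longleftrightarrow> y \<notin> W E" if "E \<in> \<E>" "y \<in> carrier G" for E y
    proof -
      have "finite E" using that \<E> by (auto simp: Fpow_def)
      moreover have "max 0 (1 - t) = 0 \<longleftrightarrow> \<not> t < 1" for t :: real by auto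
      ultimately show ?thesis using that by (simp add: W_def)
    qed
    have "\<exists>y\<in>topspace T. \<forall>E\<in>\<E>. ?w E y = 0"
    proof (rule pseudocompact_space_common_zero[OF Cinfinite pseudocompact])
      show "|\<E>| \<le>o \<alpha>"
        using card_of_mono1[OF \<E>(1)] card_of_Fpow_ordLeq_Cinfinite[OF Cinfinite D(1)]
        by (rule ordLeq_transitive)
      fix E assume "E \<in> \<E>"
      then have E: "finite E" "E \<subseteq> Sigma \<F> D" using \<E> by (auto simp: Fpow_def)
      have cont: "continuous_map T euclideanreal (\<lambda>y. fst e (y \<otimes> inv (snd e)))" if "e \<in> E" for e
      proof -
        have "fst e \<in> \<F>" "snd e \<in> D (fst e)" using subsetD[OF E(2) that] by auto
        then have "fst e \<in> \<F>" "snd e \<in> carrier G" using D(2) by blast+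
        then show ?thesis using continuous_map_translate null_systemD(2)[OF \<F>] by blast
      qed
      show "continuous_map T euclideanreal (?w E)"
        by (intro continuous_intros cont E) auto
    next
      fix J assume J: "finite J" "J \<subseteq> \<E>"
      then have "finite (W ` J)" "W ` J \<subseteq> \<C>" using \<E> by auto
      then have "\<not> carrier G \<subseteq> \<Union>(W ` J)" using no by blast
      then obtain y where "y \<in> carrier G" "\<And>E. E \<in> J \<Longrightarrow> y \<notin> W E" by blast
      then show "\<exists>y\<in>topspace T. \<forall>E\<in>J. ?w E y = 0"
        using w0 J topspace_eq_carrier by (intro bexI[of _ y]) auto
    qed
    then obtain y where y: "y \<in> carrier G" "\<And>E. E \<in> \<E> \<Longrightarrow> ?w E y = 0"
      using topspace_eq_carrier by blast
    then have "\<And>E. E \<in> \<E> \<Longrightarrow> y \<notin> W E" using w0 by blast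
    then show False using \<C>(2) \<E>(2) y(1) by blast
  qed
  have nbhd: "\<exists>V\<in>\<W>. x \<in> V \<and> ?p ` (V \<inter> carrier G) \<subseteq> U"
    if x: "x \<in> carrier G" and U: "openin ?Y U" "?p x \<in> U" for x U
  proof -
    obtain U' where U': "openin T U'" "U = U' \<inter> ?p ` carrier G"
      using U(1) unfolding openin_subtopology by blast
    have "closedin T (topspace T - U')" "?p x \<in> topspace T - (topspace T - U')"
      using U' U(2) x topspace_eq_carrier closedin_diff[OF closedin_topspace U'(1)] by auto
    then obtain \<psi> where \<psi>: "continuous_map T (top_of_set {0..1::real}) \<psi>" "\<psi> (?p x) = 0"
        "\<psi> ` (topspace T - U') \<subseteq> {1}"
      using tychonoff unfolding tychonoff_space_def completely_regular_space_def by metis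
    have \<psi>_cont: "continuous_map T euclideanreal (\<lambda>y. 1 - \<psi> (?p y))"
    proof -
      have "continuous_map T euclideanreal \<psi>" using \<psi>(1) continuous_map_in_subtopology by blast
      from continuous_map_compose[OF continuous_map_pow this, of k]
      have "continuous_map T euclideanreal (\<lambda>y. \<psi> (?p y))" by (simp add: o_def)
      then show ?thesis by (intro continuous_intros) auto
    qed
    obtain r where r: "\<And>f. f \<in> \<F> \<Longrightarrow> r f \<in> \<F> \<and>
        (\<forall>x\<in>carrier G. \<forall>y\<in>carrier G. r f x < 1 \<longrightarrow> r f y < 1 \<longrightarrow> f (x \<otimes> inv y) = 0)"
      using \<F> unfolding null_system_def by metis
    \<comment> \<open>If no finite subset sufficed, there would be a \<open>y\<close> with
      \<open>y \<otimes> inv x\<close> in the null kernel and \<psi> equal to 1 at the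
      \<open>k\<close>-th power of \<open>y\<close>. As the kernel has exponent dividing
      \<open>k\<close>, this power equals that of \<open>x\<close>, where \<psi> is 0.\<close>
    have "\<exists>F. finite F \<and> F \<subseteq> \<F> \<and> (\<forall>y\<in>carrier G. (\<forall>f\<in>F. f (y \<otimes> inv x) = 0) \<longrightarrow> ?p y \<in> U')"
    proof (rule ccontr)
      assume "\<not> ?thesis"
      then have no: "\<exists>y\<in>carrier G. (\<forall>f\<in>F. f (y \<otimes> inv x) = 0) \<and> ?p y \<notin> U'"
        if "finite F" "F \<subseteq> \<F>" for F using that by blast
      let ?k = "\<lambda>i y. case i of None \<Rightarrow> 1 - \<psi> (?p y) | Some f \<Rightarrow> f (y \<otimes> inv x)"
      let ?I = "insert None (Some ` \<F>)"
      have "\<exists>y\<in>topspace T. \<forall>i\<in>?I. ?k i y = 0"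
      proof (rule pseudocompact_space_common_zero[OF Cinfinite pseudocompact])
        have "|Some ` \<F>| \<le>o \<alpha>"
          using card_of_image null_systemD(1)[OF \<F>] by (rule ordLeq_transitive)
        then have "|{None} \<union> Some ` \<F>| \<le>o \<alpha>"
          by (intro Un_Cinfinite_bound[OF countable_ordLeq_Cinfinite[OF Cinfinite]] Cinfinite) auto
        then show "|?I| \<le>o \<alpha>" by simp
        show "continuous_map T euclideanreal (?k i)" if "i \<in> ?I" for i
          using that \<psi>_cont continuous_map_translate[OF x null_systemD(2)[OF \<F>]] by auto
        fix J assume J: "finite J" "J \<subseteq> ?I"
        have "finite {f. Some f \<in> J}" using J(1) finite_vimageI[of J Some] by (simp add: vimage_def)
        moreover have "{f. Some f \<in> J} \<subseteq> \<F>" using J(2) by auto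
        ultimately have "\<exists>y\<in>carrier G. (\<forall>f\<in>{f. Some f \<in> J}. f (y \<otimes> inv x) = 0) \<and> ?p y \<notin> U'"
          by (rule no)
        then obtain y where y: "y \<in> carrier G" "\<And>f. Some f \<in> J \<Longrightarrow> f (y \<otimes> inv x) = 0" "?p y \<notin> U'"
          by auto
        then have "?p y \<in> topspace T - U'" using topspace_eq_carrier by simp
        then have "\<psi> (?p y) = 1" using \<psi>(3) by blast
        then show "\<exists>y\<in>topspace T. \<forall>i\<in>J. ?k i y = 0"
          using y topspace_eq_carrier by (intro bexI[of _ y]) (auto split: option.split)
      qed
      then obtain y where y: "y \<in> carrier G" "\<forall>i\<in>?I. ?k i y = 0" using topspace_eq_carrier by blast
      then have "y \<otimes> inv x \<in> null_kernel \<F>" using x by (auto simp: null_kernel_def)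
      then have "(y \<otimes> inv x) [^] k = \<one>" by (rule bounded)
      then have "?p y \<otimes> inv (?p x) = \<one>"
        using x y(1) by (simp add: nat_pow_distrib nat_pow_inv)
      from inv_equality[OF this] have "?p y = ?p x" using x y(1) by simp
      then show False using y(2) \<psi>(2) by simp
    qed
    then obtain F where F: "finite F" "F \<subseteq> \<F>"
        "\<And>y. y \<in> carrier G \<Longrightarrow> (\<forall>f\<in>F. f (y \<otimes> inv x) = 0) \<Longrightarrow> ?p y \<in> U'"
      by blast
    \<comment> \<open>The vanishing of \<open>f (y \<otimes> inv x)\<close> has to follow from
      strict inequalities at net points: a net point of \<open>r f\<close> close to both
      \<open>x\<close> and \<open>y\<close> ensures it.\<close>
    have "\<forall>f\<in>F. \<exists>a\<in>D (r f). r f (x \<otimes> inv a) < 1" using r F(2) D(3) x by blast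
    then obtain a where a: "\<And>f. f \<in> F \<Longrightarrow> a f \<in> D (r f) \<and> r f (x \<otimes> inv (a f)) < 1" by metis
    define E where "E = (\<lambda>f. (r f, a f)) ` F"
    have "E \<in> Fpow (Sigma \<F> D)" using F r a by (auto simp: Fpow_def E_def)
    moreover have "x \<in> W E" using a x by (auto simp: W_def E_def)
    moreover have "?p y \<in> U" if y: "y \<in> W E" for y
    proof -
      have yG: "y \<in> carrier G" using y by (simp add: W_def)
      have "f (y \<otimes> inv x) = 0" if f: "f \<in> F" for f
      proof -
        have "f \<in> \<F>" using f F by blast
        have "a f \<in> carrier G" using a[OF f] D(2)[of "r f"] r[OF \<open>f \<in> \<F>\<close>] by blast
        moreover have "r f (y \<otimes> inv (a f)) < 1" using y f by (auto simp: W_def E_def)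
        ultimately have "f (y \<otimes> inv (a f) \<otimes> inv (x \<otimes> inv (a f))) = 0"
          using r[OF \<open>f \<in> \<F>\<close>] a[OF f] x yG by simp
        then show ?thesis using cancel_right_translates[OF yG x \<open>a f \<in> carrier G\<close>] by simp
      qed
      then show ?thesis using F(3)[OF yG] U'(2) yG by blast
    qed
    ultimately show ?thesis unfolding \<W>_def by blast
  qed
  have Hausdorff: "Hausdorff_space ?Y"
    using tychonoff by (simp add: tychonoff_space_def Hausdorff_space_subtopology)
  have "\<exists>\<Q>. topology_base ?Y (\<Q> ` Fpow \<W>)"
    by (rule exI, rule topology_base_compact_image[OF Hausdorff top_Y]; (rule cov | rule nbhd); assumption)
  then obtain \<Q> where "topology_base ?Y (\<Q> ` Fpow \<W>)" by (rule exE)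
  moreover have "|\<Q> ` Fpow \<W>| \<le>o \<alpha>" using card_of_image \<W>_card by (rule ordLeq_transitive)
  ultimately have "weight ?Y \<le>o \<alpha>" unfolding weight_ordLeq_iff by blast
  then show ?thesis using k unfolding singular_group_def by blast
qed

subsection \<open>Elements of infinite order\<close>

text \<open>Successive approximations \<open>y n\<close> have their \<open>n\<close>-th power
  outside the kernel of \<open>\<F> n\<close>, and later ones change only by elements of that
  kernel. A common point \<open>z\<close> of the cosets satisfies all these conditions at once, so
  it has infinite order.\<close>

lemma null_kernel_not_torsion:
  assumes ns: "\<not> singular_group \<alpha> G T" and \<H>: "null_system \<H>"
  obtains x where "x \<in> null_kernel \<H>" "\<And>m::nat. m > 0 \<Longrightarrow> x [^] m \<noteq> \<one>"
proof -
  note K = subgroup.m_closed[OF subgroup_null_kernel] subgroup.m_inv_closed[OF subgroup_null_kernel]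
    subgroup.one_closed[OF subgroup_null_kernel]
  have KG: "null_kernel \<F> \<subseteq> carrier G" for \<F> by (auto simp: null_kernel_def)
  have powK: "x [^] (m::nat) \<in> null_kernel \<F>" if "null_system \<F>" "x \<in> null_kernel \<F>" for x m \<F>
    using that K by (induction m) auto
  \<comment> \<open>A stage is a pair of a null system and an approximation. Stage 0 is exempt from
    the last condition because a zeroth power lies in every kernel.\<close>
  define P where "P n p \<longleftrightarrow> null_system (fst p) \<and> \<H> \<subseteq> fst p \<and> snd p \<in> null_kernel \<H> \<and>
      (n > 0 \<longrightarrow> snd p [^] n \<notin> null_kernel (fst p))" for n :: nat and p
  define Q where "Q p p' \<longleftrightarrow> fst p \<subseteq> fst p' \<and> snd p' \<otimes> inv (snd p) \<in> null_kernel (fst p)"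
    for p p' :: "('a \<Rightarrow> real) set \<times> 'a"
  have "\<exists>p. \<forall>n. P n (p n) \<and> Q (p n) (p (Suc n))"
  proof (rule dependent_nat_choice[where P = P and Q = "\<lambda>_. Q"])
    show "\<exists>p. P 0 p" using \<H> K(3) by (intro exI[of _ "(\<H>, \<one>)"]) (simp add: P_def)
  next
    fix p n assume p: "P n p"
    obtain \<F> y where [simp]: "p = (\<F>, y)" by (cases p)
    have \<F>: "null_system \<F>" "\<H> \<subseteq> \<F>" "y \<in> null_kernel \<H>" using p by (auto simp: P_def)
    have yG: "y \<in> carrier G" using \<F>(3) KG by blast
    obtain x where x: "x \<in> null_kernel \<F>" "x [^] Suc n \<noteq> \<one>"
      using singular_group_if_null_kernel_bounded[OF \<F>(1) zero_less_Suc] ns by metis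
    have xG: "x \<in> carrier G" and x\<H>: "x \<in> null_kernel \<H>"
      using x(1) KG null_kernel_antimono[OF \<F>(2)] by blast+
    \<comment> \<open>Some \<open>x\<close> in the current kernel has nontrivial power
      \<open>Suc n\<close>, because non-singularity excludes bounded kernels. If the power of
      \<open>y\<close> is trivial, multiplying by \<open>x\<close> makes it nontrivial.\<close>
    define y' where "y' = (if y [^] Suc n \<noteq> \<one> then y else y \<otimes> x)"
    have y': "y' [^] Suc n \<noteq> \<one>"
    proof (cases "y [^] Suc n = \<one>")
      case True
      then have "(y \<otimes> x) [^] Suc n = x [^] Suc n"
        using nat_pow_distrib[OF yG xG, of "Suc n"] xG by (simp del: nat_pow_Suc)
      then show ?thesis using True x(2) unfolding y'_def by (simp del: nat_pow_Suc)
    qed (simp add: y'_def)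
    have y'\<H>: "y' \<in> null_kernel \<H>" using \<F>(3) x\<H> K(1)[OF \<H>] by (simp add: y'_def)
    have "y' \<otimes> inv y = (if y [^] Suc n \<noteq> \<one> then \<one> else x)"
      using xG yG by (simp add: y'_def m_comm[of y x] m_assoc)
    then have y'\<F>: "y' \<otimes> inv y \<in> null_kernel \<F>" using x(1) K(3)[OF \<F>(1)] by simp
    have Y: "countable {y' [^] Suc n}" "{y' [^] Suc n} \<subseteq> carrier G" "\<one> \<notin> {y' [^] Suc n}"
      using y'\<H> KG y' by (auto simp del: nat_pow_Suc)
    obtain \<F>' where "null_system \<F>'" "\<F> \<subseteq> \<F>'" "null_kernel \<F>' \<inter> {y' [^] Suc n} = {}"
      by (rule null_system_refine[OF \<F>(1) Y])
    then show "\<exists>p'. P (Suc n) p' \<and> Q p p'"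
      using \<F>(2) y'\<H> y'\<F> by (intro exI[of _ "(\<F>', y')"]) (auto simp: P_def Q_def simp del: nat_pow_Suc)
  qed
  then obtain p where p: "\<And>n. P n (p n)" "\<And>n. Q (p n) (p (Suc n))" by blast
  define \<F> where "\<F> n = fst (p n)" for n
  define y where "y n = snd (p n)" for n
  have \<F>: "null_system (\<F> n)" "\<H> \<subseteq> \<F> n" "y n \<in> null_kernel \<H>"
      "n > 0 \<Longrightarrow> y n [^] n \<notin> null_kernel (\<F> n)"
      "\<F> n \<subseteq> \<F> (Suc n)" "y (Suc n) \<otimes> inv (y n) \<in> null_kernel (\<F> n)" for n
    using p[of n] by (auto simp: P_def Q_def \<F>_def y_def)
  have yG: "y n \<in> carrier G" for n using \<F>(3) KG by blast
  have \<F>_mono: "null_kernel (\<F> n) \<subseteq> null_kernel (\<F> m)" if "m \<le> n" for m n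
    using lift_Suc_mono_le[of \<F>, OF \<F>(5) that] by (rule null_kernel_antimono)
  have y_diff: "y n \<otimes> inv (y m) \<in> null_kernel (\<F> m)" if "m \<le> n" for m n
    using that
  proof (induction n rule: dec_induct)
    case base
    then show ?case using yG K(3)[OF \<F>(1)] by simp
  next
    case (step n)
    have "y (Suc n) \<otimes> inv (y n) \<otimes> (y n \<otimes> inv (y m)) \<in> null_kernel (\<F> m)"
      using step.IH \<F>(6)[of n] \<F>_mono[OF step.hyps(1)] by (blast intro: K(1)[OF \<F>(1)])
    moreover have "y (Suc n) \<otimes> inv (y n) \<otimes> (y n \<otimes> inv (y m)) = y (Suc n) \<otimes> inv (y m)"
      using yG by (simp add: m_assoc[symmetric]) (simp add: m_assoc)
    ultimately show ?case by simp
  qed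
  have "|UNIV :: nat set| \<le>o \<alpha>" by (intro countable_ordLeq_Cinfinite Cinfinite) auto
  then obtain z where z: "z \<in> carrier G" "\<And>n. z \<otimes> inv (y n) \<in> null_kernel (\<F> n)"
  proof (rule null_kernel_cosets_common_point[where \<F> = \<F> and y = y])
    fix J :: "nat set" assume "finite J"
    then have "\<forall>i\<in>J. y (Max J) \<otimes> inv (y i) \<in> null_kernel (\<F> i)" by (auto intro!: y_diff)
    then show "\<exists>z\<in>carrier G. \<forall>i\<in>J. z \<otimes> inv (y i) \<in> null_kernel (\<F> i)" using yG by blast
  qed (use \<F>(1) yG in auto)
  show ?thesis
  proof (rule that)
    have "z \<otimes> inv (y 0) \<otimes> y 0 \<in> null_kernel \<H>"
      using z(2)[of 0] null_kernel_antimono[OF \<F>(2)[of 0]] \<F>(3)[of 0] by (blast intro: K(1)[OF \<H>])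
    then show "z \<in> null_kernel \<H>" using z(1) yG by (simp add: m_assoc)
  next
    fix m :: nat assume m: "m > 0"
    show "z [^] m \<noteq> \<one>"
    proof
      assume "z [^] m = \<one>"
      then have "(z \<otimes> inv (y m)) [^] m = inv (y m [^] m)"
        using z(1) yG by (simp add: nat_pow_distrib nat_pow_inv)
      then have "inv (y m [^] m) \<in> null_kernel (\<F> m)"
        using powK[OF \<F>(1) z(2), of m m] by simp
      then have "inv (inv (y m [^] m)) \<in> null_kernel (\<F> m)" by (rule K(2)[OF \<F>(1)])
      then show False using \<F>(4)[OF m] yG by simp
    qed
  qed
qed

section \<open>A tree of 2^\<alpha> partial products\<close>

text \<open>The tree of partial products: along the well-order \<open>\<alpha>\<close> choose null systems \<open>\<F> \<beta>\<close>, increasing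
  with \<open>\<beta>\<close>, and elements \<open>x \<beta>\<close> of the kernels of all earlier ones which have infinite order modulo
  the kernel of \<open>\<F> \<beta>\<close>.  For \<open>S \<subseteq> \<alpha>\<close> the element \<open>t \<beta> S\<close> plays the role of the (infinite) product of
  the \<open>x \<gamma>\<close> with \<open>\<gamma> \<in> S\<close> and \<open>\<gamma> < \<beta>\<close>; it has to depend only on \<open>S \<inter> {\<gamma>. \<gamma> < \<beta>}\<close>, so that different
  sets are separated at their first difference.\<close>

lemma ex_power_separated_subset:
  assumes ns: "\<not> singular_group \<alpha> G T" and \<H>: "null_system \<H>"
  obtains A where "A \<subseteq> null_kernel \<H>" "ctwo ^c \<alpha> \<le>o |A|" "power_separated G A"
proof -
  note K = subgroup.m_closed[OF subgroup_null_kernel] subgroup.m_inv_closed[OF subgroup_null_kernel]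
    subgroup.one_closed[OF subgroup_null_kernel]
  have KG: "null_kernel \<F> \<subseteq> carrier G" for \<F> by (auto simp: null_kernel_def)
  have powK: "x [^] (m::nat) \<in> null_kernel \<F>" if "null_system \<F>" "x \<in> null_kernel \<F>" for x m \<F>
    using that K by (induction m) auto
  define R where "R = \<alpha> - Id"
  have wo: "well_order_on (Field \<alpha>) \<alpha>" using card_order_on_well_order_on[of "Field \<alpha>" \<alpha>] Cinfinite by simp
  have wf: "wf R" using wo by (simp add: well_order_on_def R_def)
  have trans_R: "(\<delta>, \<beta>) \<in> R" if "(\<delta>, \<gamma>) \<in> R" "(\<gamma>, \<beta>) \<in> R" for \<delta> \<gamma> \<beta>
  proof -
    have \<alpha>: "trans \<alpha>" "antisym \<alpha>"
      using wo by (simp_all add: well_order_on_def linear_order_on_def partial_order_on_def preorder_on_def)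
    have "(\<delta>, \<gamma>) \<in> \<alpha>" "(\<gamma>, \<beta>) \<in> \<alpha>" "\<gamma> \<noteq> \<delta>" using that by (auto simp: R_def)
    then have "(\<delta>, \<beta>) \<in> \<alpha>" "\<delta> \<noteq> \<beta>" using transD[OF \<alpha>(1)] antisymD[OF \<alpha>(2)] by metis+
    then show ?thesis by (simp add: R_def)
  qed
  have total_R: "(\<gamma>, \<beta>) \<in> R \<or> (\<beta>, \<gamma>) \<in> R" if "\<gamma> \<in> Field \<alpha>" "\<beta> \<in> Field \<alpha>" "\<gamma> \<noteq> \<beta>" for \<gamma> \<beta>
    using that wo by (auto simp: R_def well_order_on_def linear_order_on_def total_on_def)
  define below where "below \<beta> = {\<gamma>. (\<gamma>, \<beta>) \<in> R}" for \<beta>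
  have below_Field: "below \<beta> \<subseteq> Field \<alpha>" for \<beta> by (auto simp: below_def R_def Field_def)
  have Field_card: "|Field \<alpha>| \<le>o \<alpha>" using Cinfinite by (simp add: card_of_Field_ordIso ordIso_imp_ordLeq)
  \<comment> \<open>The pair \<open>r\<close> holds the null system and the element chosen at
    \<beta>; the choice refers to \<open>c\<close> only below \<beta>, as well-founded recursion
    requires.\<close>
  define P where "P c \<beta> r \<longleftrightarrow> null_system (fst r) \<and> \<H> \<union> (\<Union>\<gamma>\<in>below \<beta>. fst (c \<gamma>)) \<subseteq> fst r \<and>
      snd r \<in> null_kernel (\<H> \<union> (\<Union>\<gamma>\<in>below \<beta>. fst (c \<gamma>))) \<and>
      (\<forall>m::nat. m > 0 \<longrightarrow> snd r [^] m \<notin> null_kernel (fst r))"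
    for c :: "'k \<Rightarrow> ('a \<Rightarrow> real) set \<times> 'a" and \<beta> r
  have "\<exists>c. \<forall>\<beta>. P c \<beta> (c \<beta>)"
  proof (rule dependent_wf_choice[OF wf])
    fix c c' :: "'k \<Rightarrow> ('a \<Rightarrow> real) set \<times> 'a" and \<beta> r
    assume "\<And>\<gamma>. (\<gamma>, \<beta>) \<in> R \<Longrightarrow> c \<gamma> = c' \<gamma>"
    then have "(\<Union>\<gamma>\<in>below \<beta>. fst (c \<gamma>)) = (\<Union>\<gamma>\<in>below \<beta>. fst (c' \<gamma>))" by (auto simp: below_def)
    then show "P c \<beta> r = P c' \<beta> r" by (simp add: P_def)
  next
    fix \<beta> and c :: "'k \<Rightarrow> ('a \<Rightarrow> real) set \<times> 'a"
    assume IH: "\<And>\<gamma>. (\<gamma>, \<beta>) \<in> R \<Longrightarrow> P c \<gamma> (c \<gamma>)"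
    let ?U = "\<H> \<union> (\<Union>\<gamma>\<in>below \<beta>. fst (c \<gamma>))"
    have "|below \<beta>| \<le>o \<alpha>"
      using card_of_mono1[OF below_Field] Field_card by (rule ordLeq_transitive)
    then have U: "null_system ?U"
      using IH by (intro null_system_Un \<H> null_system_UN) (auto simp: P_def below_def)
    obtain x where x: "x \<in> null_kernel ?U" "\<And>m::nat. m > 0 \<Longrightarrow> x [^] m \<noteq> \<one>"
      using null_kernel_not_torsion[OF ns U] by metis
    define X where "X = (\<lambda>m::nat. x [^] m) ` {0<..}"
    have "x \<in> carrier G" using x(1) KG by blast
    then have X: "countable X" "X \<subseteq> carrier G" by (auto simp: X_def)
    have "\<one> \<notin> X"
    proof
      assume "\<one> \<in> X"
      then obtain m :: nat where "\<one> = x [^] m" "m \<in> {0<..}" unfolding X_def by (rule imageE)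
      then show False using x(2)[of m] by simp
    qed
    with X obtain \<F> where "null_system \<F>" "?U \<subseteq> \<F>" "null_kernel \<F> \<inter> X = {}"
      by (rule null_system_refine[OF U])
    then have "P c \<beta> (\<F>, x)" using x(1) by (auto simp: P_def X_def)
    then show "\<exists>r. P c \<beta> r" by blast
  qed
  then obtain c where c: "\<And>\<beta>. P c \<beta> (c \<beta>)" by blast
  define \<F> where "\<F> \<beta> = fst (c \<beta>)" for \<beta>
  define x where "x \<beta> = snd (c \<beta>)" for \<beta>
  have \<F>: "null_system (\<F> \<beta>)" "\<H> \<subseteq> \<F> \<beta>" and x: "x \<beta> \<in> null_kernel \<H>"
      "m > 0 \<Longrightarrow> x \<beta> [^] m \<notin> null_kernel (\<F> \<beta>)" for \<beta> and m :: nat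
    using c[of \<beta>] by (auto simp: P_def \<F>_def x_def null_kernel_def)
  have below: "\<F> \<gamma> \<subseteq> \<F> \<beta>" "x \<beta> \<in> null_kernel (\<F> \<gamma>)" if "(\<gamma>, \<beta>) \<in> R" for \<gamma> \<beta>
    using c[of \<beta>] that by (auto simp: P_def \<F>_def x_def null_kernel_def below_def)
  have xG: "x \<beta> \<in> carrier G" for \<beta> using x KG by blast
  \<comment> \<open>The factor contributed at \<gamma> to the product that belongs to
    \<open>S\<close>.\<close>
  define xs where "xs S \<gamma> = (if \<gamma> \<in> S then x \<gamma> else \<one>)" for S \<gamma>
  have xsG: "xs S \<gamma> \<in> carrier G" and xs\<H>: "xs S \<gamma> \<in> null_kernel \<H>" for S \<gamma>
    using xG x(1) K(3)[OF \<H>] by (auto simp: xs_def)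
  have xs_below: "xs S \<beta> \<in> null_kernel (\<F> \<gamma>)" if "(\<gamma>, \<beta>) \<in> R" for S \<gamma> \<beta>
    using below(2)[OF that] K(3)[OF \<F>(1)] by (auto simp: xs_def)

  have finite_max: "\<exists>\<gamma>\<in>J. \<forall>\<delta>\<in>J. \<delta> = \<gamma> \<or> (\<delta>, \<gamma>) \<in> R" if "finite J" "J \<noteq> {}" "J \<subseteq> Field \<alpha>" for J
    using that
  proof (induction J rule: finite_ne_induct)
    case (insert \<beta> J)
    then obtain \<gamma> where \<gamma>: "\<gamma> \<in> J" "\<forall>\<delta>\<in>J. \<delta> = \<gamma> \<or> (\<delta>, \<gamma>) \<in> R" by auto
    then have "(\<gamma>, \<beta>) \<in> R \<or> (\<beta>, \<gamma>) \<in> R" using total_R[of \<gamma> \<beta>] insert by blast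
    then show ?case
    proof
      assume "(\<gamma>, \<beta>) \<in> R"
      then show ?thesis using \<gamma> trans_R by (intro bexI[of _ \<beta>]) auto
    next
      assume "(\<beta>, \<gamma>) \<in> R"
      then show ?thesis using \<gamma> by (intro bexI[of _ \<gamma>]) auto
    qed
  qed simp

  \<comment> \<open>Coherent partial products have a common continuation. For finitely many indices
    the product up to and including the greatest one serves, since its extra factor lies in all
    earlier kernels; the general case is the common point of cosets.\<close>
  have glue: "\<exists>z\<in>null_kernel \<H>. \<forall>\<gamma>\<in>A. z \<otimes> inv (s \<gamma> \<otimes> xs S \<gamma>) \<in> null_kernel (\<F> \<gamma>)"
    if A: "A \<subseteq> Field \<alpha>" and s: "\<And>\<gamma>. \<gamma> \<in> A \<Longrightarrow> s \<gamma> \<in> null_kernel \<H>"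
      and coh: "\<And>\<gamma> \<delta>. \<gamma> \<in> A \<Longrightarrow> \<delta> \<in> A \<Longrightarrow> (\<delta>, \<gamma>) \<in> R \<Longrightarrow>
        s \<gamma> \<otimes> inv (s \<delta> \<otimes> xs S \<delta>) \<in> null_kernel (\<F> \<delta>)"
    for A S s
  proof (cases "A = {}")
    case True
    then show ?thesis using K(3)[OF \<H>] by blast
  next
    case False
    define y where "y \<gamma> = s \<gamma> \<otimes> xs S \<gamma>" for \<gamma>
    have sG: "s \<gamma> \<in> carrier G" if "\<gamma> \<in> A" for \<gamma> using s[OF that] KG by blast
    have yG: "y \<gamma> \<in> carrier G" and y\<H>: "y \<gamma> \<in> null_kernel \<H>" if "\<gamma> \<in> A" for \<gamma>
      using sG[OF that] s[OF that] xsG xs\<H> K(1)[OF \<H>] by (auto simp: y_def)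
    have "|A| \<le>o \<alpha>" using card_of_mono1[OF A] Field_card by (rule ordLeq_transitive)
    then obtain z where z: "z \<in> carrier G" "\<And>\<gamma>. \<gamma> \<in> A \<Longrightarrow> z \<otimes> inv (y \<gamma>) \<in> null_kernel (\<F> \<gamma>)"
    proof (rule null_kernel_cosets_common_point[where \<F> = \<F> and y = y])
      fix J assume J: "finite J" "J \<subseteq> A"
      show "\<exists>z\<in>carrier G. \<forall>i\<in>J. z \<otimes> inv (y i) \<in> null_kernel (\<F> i)"
      proof (cases "J = {}")
        case False
        then obtain \<gamma> where \<gamma>: "\<gamma> \<in> J" "\<forall>\<delta>\<in>J. \<delta> = \<gamma> \<or> (\<delta>, \<gamma>) \<in> R"
          using finite_max J A by (meson subset_trans)
        have "y \<gamma> \<otimes> inv (y \<delta>) \<in> null_kernel (\<F> \<delta>)" if \<delta>: "\<delta> \<in> J" for \<delta>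
        proof (cases "\<delta> = \<gamma>")
          case True
          then show ?thesis using yG \<delta> J K(3)[OF \<F>(1)] by auto
        next
          case False
          then have R: "(\<delta>, \<gamma>) \<in> R" using \<gamma>(2) \<delta> by blast
          have A': "\<gamma> \<in> A" "\<delta> \<in> A" using \<gamma>(1) \<delta> J by auto
          have "y \<gamma> \<otimes> inv (y \<delta>) = s \<gamma> \<otimes> inv (s \<delta> \<otimes> xs S \<delta>) \<otimes> xs S \<gamma>"
            using sG A' xsG by (simp add: y_def m_assoc m_comm[of "xs S \<gamma>"])
          then show ?thesis using coh[OF A' R] xs_below[OF R] K(1)[OF \<F>(1)] by simp
        qed
        then show ?thesis using yG \<gamma>(1) J by blast
      qed auto
    qed (use \<F>(1) yG in auto)
    obtain \<gamma> where \<gamma>: "\<gamma> \<in> A" using False by blast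
    have "z \<otimes> inv (y \<gamma>) \<otimes> y \<gamma> \<in> null_kernel \<H>"
      using z(2)[OF \<gamma>] null_kernel_antimono[OF \<F>(2)] y\<H>[OF \<gamma>] by (blast intro: K(1)[OF \<H>])
    then have "z \<in> null_kernel \<H>" using z(1) yG[OF \<gamma>] by (simp add: m_assoc)
    then show ?thesis using z(2) unfolding y_def by blast
  qed

  \<comment> \<open>The equation \<open>r S = r (S \<inter> below \<beta>)\<close> makes sets that
    agree below \<beta> share the same partial product exactly, not merely modulo a kernel.\<close>
  define C where "C t \<beta> r \<longleftrightarrow> (\<forall>S. r S \<in> null_kernel \<H> \<and> r S = r (S \<inter> below \<beta>) \<and>
      (\<forall>\<gamma>\<in>below \<beta>. r S \<otimes> inv (t \<gamma> S \<otimes> xs S \<gamma>) \<in> null_kernel (\<F> \<gamma>)))"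
    for t :: "'k \<Rightarrow> 'k set \<Rightarrow> 'a" and \<beta> r
  have C_D: "r S \<in> null_kernel \<H>" "r S = r (S \<inter> below \<beta>)"
      "\<forall>\<gamma>\<in>below \<beta>. r S \<otimes> inv (t \<gamma> S \<otimes> xs S \<gamma>) \<in> null_kernel (\<F> \<gamma>)"
    if "C t \<beta> r" for t \<beta> r S
  proof -
    note C = that[unfolded C_def, THEN spec, of S]
    show "r S \<in> null_kernel \<H>" by (rule conjunct1[OF C])
    show "r S = r (S \<inter> below \<beta>)" by (rule conjunct1[OF conjunct2[OF C]])
    show "\<forall>\<gamma>\<in>below \<beta>. r S \<otimes> inv (t \<gamma> S \<otimes> xs S \<gamma>) \<in> null_kernel (\<F> \<gamma>)"
      by (rule conjunct2[OF conjunct2[OF C]])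
  qed
  have "\<exists>t. \<forall>\<beta>. C t \<beta> (t \<beta>)"
  proof (rule dependent_wf_choice[OF wf])
    fix t t' :: "'k \<Rightarrow> 'k set \<Rightarrow> 'a" and \<beta> r
    assume "\<And>\<gamma>. (\<gamma>, \<beta>) \<in> R \<Longrightarrow> t \<gamma> = t' \<gamma>"
    then show "C t \<beta> r = C t' \<beta> r" by (simp add: C_def below_def)
  next
    fix \<beta> and t :: "'k \<Rightarrow> 'k set \<Rightarrow> 'a"
    assume "\<And>\<gamma>. (\<gamma>, \<beta>) \<in> R \<Longrightarrow> C t \<gamma> (t \<gamma>)"
    then have "C t \<gamma> (t \<gamma>)" if "\<gamma> \<in> below \<beta>" for \<gamma> using that by (simp add: below_def)
    note IH = C_D[OF this]
    have "\<forall>S. \<exists>z\<in>null_kernel \<H>. \<forall>\<gamma>\<in>below \<beta>. z \<otimes> inv (t \<gamma> S \<otimes> xs S \<gamma>) \<in> null_kernel (\<F> \<gamma>)"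
      using IH(1,3) by (intro allI glue below_Field) (auto simp: below_def)
    then obtain z where z: "\<And>S. z S \<in> null_kernel \<H>"
        "\<And>S \<gamma>. \<gamma> \<in> below \<beta> \<Longrightarrow> z S \<otimes> inv (t \<gamma> S \<otimes> xs S \<gamma>) \<in> null_kernel (\<F> \<gamma>)"
      by metis
    \<comment> \<open>Applying the chosen \<open>z\<close> to the trace of \<open>S\<close> enforces
      this dependence; by induction the earlier partial products do not notice the
      replacement.\<close>
    have "C t \<beta> (\<lambda>S. z (S \<inter> below \<beta>))"
      unfolding C_def
    proof (intro allI conjI ballI)
      fix S \<gamma> assume \<gamma>: "\<gamma> \<in> below \<beta>"
      then have "S \<inter> below \<beta> \<inter> below \<gamma> = S \<inter> below \<gamma>" using trans_R by (auto simp: below_def)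
      then have "t \<gamma> (S \<inter> below \<beta>) = t \<gamma> S" using IH(2)[OF \<gamma>] by metis
      moreover have "xs (S \<inter> below \<beta>) \<gamma> = xs S \<gamma>" using \<gamma> by (simp add: xs_def)
      ultimately show "z (S \<inter> below \<beta>) \<otimes> inv (t \<gamma> S \<otimes> xs S \<gamma>) \<in> null_kernel (\<F> \<gamma>)"
        using z(2)[OF \<gamma>, of "S \<inter> below \<beta>"] by simp
    qed (simp_all add: z(1) Int_assoc)
    then show "\<exists>r. C t \<beta> r" by blast
  qed
  then obtain t where "\<forall>\<beta>. C t \<beta> (t \<beta>)" by (rule exE)
  then have "C t \<beta> (t \<beta>)" for \<beta> by (rule spec)
  note t = C_D[OF this]
  have tG: "t \<gamma> S \<in> carrier G" for \<gamma> S using t(1) KG by blast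
  \<comment> \<open>One last gluing over all of \<open>Field \<alpha>\<close> gives the full product
    \<open>Y S\<close>.\<close>
  have "\<forall>S. \<exists>z\<in>null_kernel \<H>. \<forall>\<gamma>\<in>Field \<alpha>. z \<otimes> inv (t \<gamma> S \<otimes> xs S \<gamma>) \<in> null_kernel (\<F> \<gamma>)"
    using t(1,3) by (intro allI glue) (auto simp: below_def)
  then obtain Y where Y: "\<And>S. Y S \<in> null_kernel \<H>"
      "\<And>S \<gamma>. \<gamma> \<in> Field \<alpha> \<Longrightarrow> Y S \<otimes> inv (t \<gamma> S \<otimes> xs S \<gamma>) \<in> null_kernel (\<F> \<gamma>)"
    by metis
  have YG: "Y S \<in> carrier G" for S using Y(1) KG by blast

  \<comment> \<open>At the first difference \<gamma> both products continue the same
    \<open>a\<close>. Modulo the kernel of \<open>\<F> \<gamma>\<close>, one is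
    \<open>a \<otimes> x \<gamma>\<close> and the other is \<open>a\<close>, so equal
    \<open>m\<close>-th powers would put a positive power of \<open>x \<gamma>\<close> into that
    kernel.\<close>
  have differ: "Y S [^] m \<noteq> Y S' [^] m"
    if m: "m > 0" and \<gamma>: "\<gamma> \<in> Field \<alpha>" "\<gamma> \<in> S" "\<gamma> \<notin> S'" "S \<inter> below \<gamma> = S' \<inter> below \<gamma>" for m :: nat and \<gamma> S S'
  proof
    assume eq: "Y S [^] m = Y S' [^] m"
    define a where "a = t \<gamma> S"
    have a: "a \<in> carrier G" "t \<gamma> S' = a" using tG t(2) \<gamma>(4) unfolding a_def by metis+
    define u where "u = Y S \<otimes> inv (a \<otimes> x \<gamma>)"
    define v where "v = Y S' \<otimes> inv a"
    have u: "u \<in> null_kernel (\<F> \<gamma>)" and v: "v \<in> null_kernel (\<F> \<gamma>)"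
      using Y(2)[OF \<gamma>(1), of S] Y(2)[OF \<gamma>(1), of S'] \<gamma> a
      by (auto simp: u_def v_def xs_def a_def)
    have uvG: "u \<in> carrier G" "v \<in> carrier G" using u v KG by blast+
    have "u \<otimes> x \<gamma> = Y S \<otimes> inv a"
      using a(1) xG YG by (simp add: u_def inv_mult m_assoc)
    then have "(u \<otimes> x \<gamma>) [^] m = v [^] m"
      using eq a(1) YG by (simp add: v_def nat_pow_distrib)
    then have "u [^] m \<otimes> x \<gamma> [^] m = v [^] m"
      using uvG xG by (simp add: nat_pow_distrib)
    then have "x \<gamma> [^] m = inv (u [^] m) \<otimes> v [^] m"
      using uvG xG by (metis inv_solve_left nat_pow_closed)
    also have "\<dots> \<in> null_kernel (\<F> \<gamma>)"
      by (intro K(1,2) powK \<F>(1) u v)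
    finally show False using x(2)[OF m] by blast
  qed
  have sep: "S = S'" if S: "S \<subseteq> Field \<alpha>" "S' \<subseteq> Field \<alpha>" and m: "m > 0" and eq: "Y S [^] m = Y S' [^] m"
    for S S' and m :: nat
  proof (rule ccontr)
    assume "S \<noteq> S'"
    then have "(S - S') \<union> (S' - S) \<noteq> {}" by blast
    then obtain \<gamma> where \<gamma>: "\<gamma> \<in> (S - S') \<union> (S' - S)"
        "\<And>\<delta>. (\<delta>, \<gamma>) \<in> R \<Longrightarrow> \<delta> \<notin> (S - S') \<union> (S' - S)"
      using wfE_min'[OF wf, of "(S - S') \<union> (S' - S)"] by blast
    have "S \<inter> below \<gamma> = S' \<inter> below \<gamma>" using \<gamma>(2) by (auto simp: below_def)
    moreover have "\<gamma> \<in> Field \<alpha>" using \<gamma>(1) S by blast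
    ultimately show False
      using differ[OF m, of \<gamma> S S'] differ[OF m, of \<gamma> S' S] \<gamma>(1) eq by auto
  qed
  show ?thesis
  proof (rule that[of "Y ` Pow (Field \<alpha>)"])
    show "Y ` Pow (Field \<alpha>) \<subseteq> null_kernel \<H>" using Y(1) by blast
    show "power_separated G (Y ` Pow (Field \<alpha>))"
      unfolding power_separated_def using sep by blast
    have "inj_on Y (Pow (Field \<alpha>))"
      using sep[of _ _ 1] YG unfolding inj_on_def by auto
    then have "|Pow (Field \<alpha>)| \<le>o |Y ` Pow (Field \<alpha>)|"
      by (auto simp: card_of_ordLeq[symmetric])
    moreover have "ctwo ^c \<alpha> =o |Pow (Field \<alpha>)|"
      using cpow_cexp_ctwo ordIso_symmetric unfolding cpow_def by blast
    ultimately show "ctwo ^c \<alpha> \<le>o |Y ` Pow (Field \<alpha>)|" using ordIso_ordLeq_trans by blast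
  qed
qed

end

section \<open>Comparison of the ranks of \<open>N\<close> and \<open>G\<close>\<close>

theorem proposition5p7:
  fixes \<alpha> :: "'k rel"
    and G :: "('a, 'b) monoid_scheme"
    and T :: "'a topology"
  assumes "Cinfinite \<alpha>"
    and "topological_group G T"
    and "comm_group G"
    and "tychonoff_space T"
    and "pseudocompact_space \<alpha> T"
    and "\<not> singular_group \<alpha> G T"
  shows "\<forall>N \<in> Lambda_family \<alpha> G T.
           free_rank (G\<lparr>carrier := N\<rparr>) =o free_rank G \<and> ctwo ^c \<alpha> \<le>o free_rank G"
proof
  interpret pseudocompact_abelian_group G T \<alpha>
    by (intro pseudocompact_abelian_group.intro pseudocompact_abelian_group_axioms.intro assms)
  fix N assume N: "N \<in> Lambda_family \<alpha> G T"
  then have subN: "subgroup N G" by (simp add: Lambda_family_def normal_imp_subgroup)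
  obtain \<H> where \<H>: "null_system \<H>" "null_kernel \<H> \<subseteq> N"
    using ex_null_system_Lambda_family[OF N] .
  obtain A where A: "A \<subseteq> null_kernel \<H>" "ctwo ^c \<alpha> \<le>o |A|" "power_separated G A"
    using ex_power_separated_subset[OF assms(6) \<H>(1)] .
  obtain q :: "'a \<Rightarrow> (('a \<Rightarrow> real) \<times> 'a) set" where q: "|q ` carrier G| \<le>o ctwo ^c \<alpha>"
    "\<And>x y. x \<in> carrier G \<Longrightarrow> y \<in> carrier G \<Longrightarrow> q x = q y \<Longrightarrow> x \<otimes>\<^bsub>G\<^esub> inv\<^bsub>G\<^esub> y \<in> null_kernel \<H>"
    using null_kernel_index[OF \<H>(1)] by metis
  show "free_rank (G\<lparr>carrier := N\<rparr>) =o free_rank G \<and> ctwo ^c \<alpha> \<le>o free_rank G"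
  \<comment> \<open>Here \<kappa> is 2^\<alpha>, uncountable by Cantor's theorem. The map
    \<open>q\<close> classifies elements modulo the null kernel, which is contained in
    \<open>N\<close>.\<close>
  proof (rule free_rank_subgroup[OF subN Card_order_cexp _ _ A(2,3) q(1)])
    have "natLeq \<le>o \<alpha>" "\<alpha> <o ctwo ^c \<alpha>"
      using assms(1) by (auto intro: natLeq_ordLeq_cinfinite ordLess_ctwo_cexp)
    then show "natLeq <o ctwo ^c \<alpha>" by (rule ordLeq_ordLess_trans)
    show "A \<subseteq> N" using A(1) \<H>(2) by blast
    show "x \<otimes>\<^bsub>G\<^esub> inv\<^bsub>G\<^esub> y \<in> N" if "x \<in> carrier G" "y \<in> carrier G" "q x = q y" for x y
      using q(2)[OF that] \<H>(2) by blast
  qed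
qed

end
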